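(* Let $I=(a_-,a_+)\subset\mathbb{R}$ be a bounded open interval, $p\in[1,\infty)$, $w\in L^1(I)$ a weight, $x_0\in\bar I$ and $k\ge0$ an integer. (Right-sided version.) Assume that there exists $r>0$ such that $w\in L^\infty(B_+(x_0,r)\cap I)$. If $x_0\in\bar I_{cr,+}^{\,k,p}(w)$, then there exists a sequence $(\hat\phi_h)_h$ satisfying $$\hat\phi_h\in\mathcal{D}\big(B_+(x_0,1/h)\big),\qquad \hat\phi_h\ge0,\qquad \int_I\hat\phi_h\,dx=1,\qquad \|D^k\hat\phi_h\|_{L^p_{\mu_w}}\xrightarrow[h\to\infty]{}0 .$$ (Left-sided version.) The same result holds for a left-sided critical point $x_0\in\bar I_{cr,-}^{\,k,p}(w)$ with the half-balls $B_+$ above replaced everywhere by the half-balls $B_-$.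
   Context: A weight is a non-negative function $w\in L^1(I)$. $\mathcal{L}^1$ is Lebesgue measure, $\mu_w:=w\,\mathcal{L}^1$ restricted to $I$, and $\|v\|_{L^p_{\mu_w}}=(\int_I w|v|^p\,dx)^{1/p}$. $p'=p/(p-1)$ is the Hölder conjugate. Convention: $\alpha/0=0$ if $\alpha=0$ and $\alpha/0=\infty$ if $\alpha>0$. $\mathcal{D}(U)$ denotes smooth functions compactly supported in the open set $U\subset\mathbb{R}$; $D^k$ is the classical derivative of order $k$. Half-balls: $B_-(x_0,\varepsilon):=(x_0-\varepsilon,x_0)$, $B_+(x_0,\varepsilon):=(x_0,x_0+\varepsilon)$. One-sided critical sets of order $\alpha\ge0$: for $p\in(1,\infty)$, $$\bar I_{cr,\pm}^{\,\alpha,p}(w):=\Big\{x_0\in\bar I:\ \forall\varepsilon>0\ \int_{\bar I\cap B_\pm(x_0,\varepsilon)}\Big(\frac{|x-x_0|^\alpha}{(w(x))^{1/p}}\Big)^{p'}dx=\infty\Big\},$$ and for $p=1$, $\bar I_{cr,\pm}^{\,\alpha,1}(w):=\{x_0\in\bar I:\ \forall\varepsilon>0\ \ \mathcal{L}^1\text{-}\mathrm{ess\,sup}\{|x-x_0|^\alpha/w(x): x\in\bar I\cap B_\pm(x_0,\varepsilon)\}=\infty\}$. (In particular $a_+$ is never right-sided critical and $a_-$ is never left-sided critical.) *)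

theory Defs
  imports "HOL-Analysis.Analysis" "HOL-Probability.Essential_Supremum"
begin

text \<open>
  Powers of extended non-negative reals with a real exponent. Only positive exponents are used
  below, for which \<open>\<infinity>\<close> to the power \<open>r\<close> is \<open>\<infinity>\<close> and \<open>0\<close> to the power \<open>r\<close> is \<open>0\<close>.
\<close>

definition epowr :: "ennreal \<Rightarrow> real \<Rightarrow> ennreal" where
  "epowr x r = (if x = \<infinity> then \<infinity> else ennreal (enn2real x powr r))"

text \<open>
  Weights and the functions below are represented by functions on all of \<open>\<real>\<close>, of which only the
  values in \<open>I\<close> matter. As \<open>w\<close> is an element of \<open>L\<^sup>1(I)\<close>, non-negativity is required up
  to a null set.
\<close>

definition weight :: "real set \<Rightarrow> (real \<Rightarrow> real) \<Rightarrow> bool" where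
  "weight I w \<longleftrightarrow> integrable (lebesgue_on I) w \<and> (AE x in lebesgue_on I. 0 \<le> w x)"

definition L_infinity :: "real set \<Rightarrow> (real \<Rightarrow> real) set" where
  "L_infinity S = {w. w \<in> borel_measurable (lebesgue_on S) \<and>
                      esssup (lebesgue_on S) (\<lambda>x. ennreal \<bar>w x\<bar>) < \<infinity>}"

text \<open>The value is allowed to be \<open>\<infinity>\<close>, so a small norm implies integrability.\<close>

definition weighted_Lp_norm :: "real \<Rightarrow> real set \<Rightarrow> (real \<Rightarrow> real) \<Rightarrow> (real \<Rightarrow> real) \<Rightarrow> ennreal" where
  "weighted_Lp_norm p I w v =
     epowr (\<integral>\<^sup>+ x. ennreal (w x) * ennreal (\<bar>v x\<bar> powr p) \<partial>lebesgue_on I) (1 / p)"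

text \<open>
  Smooth functions with compact support in \<open>U\<close>, extended by zero to \<open>\<real>\<close>. The derivative of
  order \<open>k\<close> is \<open>(deriv ^^ k) \<phi>\<close>.
\<close>

definition test_functions :: "real set \<Rightarrow> (real \<Rightarrow> real) set" where
  "test_functions U = {\<phi>. (\<forall>k x. (deriv ^^ k) \<phi> differentiable (at x)) \<and>
                          compact (closure {x. \<phi> x \<noteq> 0}) \<and> closure {x. \<phi> x \<noteq> 0} \<subseteq> U}"

definition half_ball_left :: "real \<Rightarrow> real \<Rightarrow> real set" where
  "half_ball_left x0 \<epsilon> = {x0 - \<epsilon><..<x0}"

definition half_ball_right :: "real \<Rightarrow> real \<Rightarrow> real set" where
  "half_ball_right x0 \<epsilon> = {x0<..<x0 + \<epsilon>}"

definition holder_conjugate :: "real \<Rightarrow> real" where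
  "holder_conjugate p = p / (p - 1)"

text \<open>
  The critical set of order \<open>\<alpha>\<close> with respect to a family \<open>B\<close> of half-balls. Division in
  \<^typ>\<open>ennreal\<close> satisfies \<open>0 / 0 = 0\<close> and \<open>a / 0 = \<infinity>\<close> for \<open>a > 0\<close>.
\<close>

definition critical_set ::
  "(real \<Rightarrow> real \<Rightarrow> real set) \<Rightarrow> real \<Rightarrow> real \<Rightarrow> real set \<Rightarrow> (real \<Rightarrow> real) \<Rightarrow> real set" where
  "critical_set B \<alpha> p I w =
     (if p = 1 then
        {x0 \<in> closure I. \<forall>\<epsilon>>0.
           esssup (lebesgue_on (closure I \<inter> B x0 \<epsilon>))
             (\<lambda>x. ennreal (\<bar>x - x0\<bar> powr \<alpha>) / ennreal (w x)) = \<infinity>}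
      else
        {x0 \<in> closure I. \<forall>\<epsilon>>0.
           (\<integral>\<^sup>+ x. epowr (ennreal (\<bar>x - x0\<bar> powr \<alpha>) / epowr (ennreal (w x)) (1 / p))
                      (holder_conjugate p)
              \<partial>lebesgue_on (closure I \<inter> B x0 \<epsilon>)) = \<infinity>})"

abbreviation critical_set_left ::
  "real \<Rightarrow> real \<Rightarrow> real set \<Rightarrow> (real \<Rightarrow> real) \<Rightarrow> real set" where
  "critical_set_left \<equiv> critical_set half_ball_left"

abbreviation critical_set_right ::
  "real \<Rightarrow> real \<Rightarrow> real set \<Rightarrow> (real \<Rightarrow> real) \<Rightarrow> real set" where
  "critical_set_right \<equiv> critical_set half_ball_right"

end

theory Submission
  imports Defs
begin

text \<open>
  After the substitution \<open>x = x\<^sub>0 \<plusminus> t\<close> both versions become a statement on the right of \<open>0\<close> about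
  a bounded Borel weight \<open>v \<ge> 0\<close>. Write \<open>J(u) = \<integral> v \<bar>u\<bar>\<^sup>p\<close> for the cost of \<open>u\<close>, and say that
  \<open>A(k, m)\<close> holds if arbitrarily close to \<open>0\<close> there are bumps \<open>u \<ge> 0\<close> with \<open>\<integral> x\<^sup>m u \<ge> 1\<close> for
  which \<open>D\<^sup>k u\<close> has arbitrarily small cost (\<open>cheap\<close> below). The goal is \<open>A(k, 0)\<close>.

  Criticality of order \<open>m\<close> says that the functional \<open>u \<mapsto> \<integral> x\<^sup>m u\<close> is unbounded with respect to the
  norm of \<open>L\<^sup>p(v)\<close> on every interval \<open>(0, \<epsilon>)\<close>. By the equality case of Hoelder's inequality, a truncation of \<open>(x\<^sup>m / v)\<close> to the power
  \<open>1 / (p - 1)\<close> (for \<open>p = 1\<close>, the indicator of a set where \<open>v\<close> is small compared with \<open>x\<^sup>m\<close>) has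
  small cost once its \<open>m\<close>-th moment is normalised. Smoothing it gives \<open>A(0, m)\<close> (\<open>cheap_0_of_critical\<close>).

  The derivative is then raised one step at a time: \<open>A(k, m + 1)\<close> implies \<open>A(k + 1, m)\<close>
  (\<open>cheap_Suc\<close>). Take \<open>\<psi>\<close> from \<open>A(k, m + 1)\<close>. The function \<open>x \<mapsto> \<integral>\<^sub>x\<^sup>\<infinity> \<psi>\<close> has the right derivatives
  up to sign, and its \<open>m\<close>-th moment is that of \<open>\<psi>\<close> of order \<open>m + 1\<close> up to the factor \<open>m + 1\<close>; but it
  does not vanish near \<open>0\<close>. As \<open>A(k, m + 1)\<close> also implies \<open>A(k, 0)\<close>, there is a bump \<open>f\<close>
  to the left of \<open>supp \<psi>\<close> with \<open>\<integral> f = \<integral> \<psi>\<close> and with \<open>D\<^sup>k f\<close> of small cost. The antiderivative of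
  \<open>f - \<psi>\<close> rises from \<open>0\<close> on \<open>supp f\<close> and falls back to \<open>0\<close> on \<open>supp \<psi>\<close>, so it is a bump, and
  pushing \<open>f\<close> towards \<open>0\<close> makes the loss in the moment negligible. Non-negativity thus comes from
  the order of the supports alone. Starting from \<open>A(0, k)\<close>, this reaches \<open>A(k, 0)\<close> after \<open>k\<close> steps.
\<close>

section \<open>Smooth functions on the line and a bump\<close>

definition smooth :: "(real \<Rightarrow> real) \<Rightarrow> bool" where
  "smooth f \<longleftrightarrow> (\<forall>k x. (deriv ^^ k) f differentiable (at x))"

text \<open>
  Unlike the iterated total function \<^const>\<open>deriv\<close>, this recursive notion passes through sums,
  products and substitutions by induction on the order.
\<close>

primrec times_differentiable :: "nat \<Rightarrow> (real \<Rightarrow> real) \<Rightarrow> bool" where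
  "times_differentiable 0 f \<longleftrightarrow> True"
| "times_differentiable (Suc n) f \<longleftrightarrow>
     (\<exists>f'. (\<forall>x. (f has_real_derivative f' x) (at x)) \<and> times_differentiable n f')"

lemma deriv_funpow_Suc: "(deriv ^^ Suc k) f = (deriv ^^ k) (deriv f)"
  by (simp add: funpow_swap1)

lemma has_derivative_imp_deriv_eq:
  fixes f :: "real \<Rightarrow> real"
  shows "(\<And>x. (f has_real_derivative f' x) (at x)) \<Longrightarrow> deriv f = f'"
  by (intro ext DERIV_imp_deriv) simp

lemma smooth_iff_times_differentiable: "smooth f \<longleftrightarrow> (\<forall>n. times_differentiable n f)"
proof
  assume f: "smooth f"
  have "smooth f \<Longrightarrow> times_differentiable n f" for n
  proof (induction n arbitrary: f)
    case (Suc n)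
    have "(f has_real_derivative deriv f x) (at x)" for x
      using Suc.prems[unfolded smooth_def, rule_format, of 0 x]
      by (auto simp: DERIV_deriv_iff_real_differentiable)
    moreover have "smooth (deriv f)"
      unfolding smooth_def
    proof (intro allI)
      fix k x show "(deriv ^^ k) (deriv f) differentiable at x"
        using Suc.prems[unfolded smooth_def, rule_format, of "Suc k" x]
        unfolding deriv_funpow_Suc .
    qed
    ultimately show ?case
      using Suc.IH by auto
  qed simp
  with f show "\<forall>n. times_differentiable n f" by blast
next
  assume f: "\<forall>n. times_differentiable n f"
  have "times_differentiable (Suc k) f \<Longrightarrow> (deriv ^^ k) f differentiable (at x)" for k x
  proof (induction k arbitrary: f)
    case 0
    then show ?case
      by (auto simp: real_differentiable_def)
  next
    case (Suc k)
    then obtain f' where "\<And>x. (f has_real_derivative f' x) (at x)" "times_differentiable (Suc k) f'"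
      by (metis times_differentiable.simps(2))
    with Suc.IH[of f'] show ?case
      unfolding deriv_funpow_Suc by (metis has_derivative_imp_deriv_eq)
  qed
  with f show "smooth f" unfolding smooth_def by blast
qed

lemma smooth_has_derivative:
  "smooth f \<Longrightarrow> (f has_real_derivative deriv f x) (at x)"
  unfolding smooth_def
  by (metis DERIV_deriv_iff_real_differentiable funpow_0)

lemma smooth_deriv: "smooth f \<Longrightarrow> smooth (deriv f)"
  unfolding smooth_def by (metis deriv_funpow_Suc)

lemma smooth_funpow_deriv: "smooth f \<Longrightarrow> smooth ((deriv ^^ k) f)"
  by (induction k) (auto intro: smooth_deriv)

lemma smooth_antiderivative:
  assumes "\<And>x. (f has_real_derivative f' x) (at x)" "smooth f'"
  shows "smooth f"
  unfolding smooth_iff_times_differentiable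
proof
  fix n show "times_differentiable n f"
    using assms by (cases n) (auto simp: smooth_iff_times_differentiable)
qed

lemma smooth_continuous_on: "smooth f \<Longrightarrow> continuous_on S f"
  by (meson smooth_has_derivative DERIV_continuous continuous_at_imp_continuous_on)

lemma smooth_borel [measurable_dest]: "smooth f \<Longrightarrow> f \<in> borel_measurable borel"
  by (intro borel_measurable_continuous_onI smooth_continuous_on)

lemma times_differentiable_add:
  "times_differentiable n f \<Longrightarrow> times_differentiable n g \<Longrightarrow> times_differentiable n (\<lambda>x. f x + g x)"
proof (induction n arbitrary: f g)
  case (Suc n)
  then obtain f' g' where *: "\<And>x. (f has_real_derivative f' x) (at x)" "times_differentiable n f'"
    "\<And>x. (g has_real_derivative g' x) (at x)" "times_differentiable n g'"
    by auto
  show ?case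
    using Suc.IH[OF *(2,4)] by (auto intro!: exI[of _ "\<lambda>x. f' x + g' x"] DERIV_add *)
qed simp

lemma times_differentiable_Suc_imp: "times_differentiable (Suc n) f \<Longrightarrow> times_differentiable n f"
proof (induction n arbitrary: f)
  case (Suc n)
  then show ?case by (metis times_differentiable.simps(2))
qed simp

lemma times_differentiable_mult:
  "times_differentiable n f \<Longrightarrow> times_differentiable n g \<Longrightarrow> times_differentiable n (\<lambda>x. f x * g x)"
proof (induction n arbitrary: f g)
  case (Suc n)
  then obtain f' g' where *: "\<And>x. (f has_real_derivative f' x) (at x)" "times_differentiable n f'"
    "\<And>x. (g has_real_derivative g' x) (at x)" "times_differentiable n g'"
    by auto
  have "times_differentiable n f" "times_differentiable n g"
    using Suc.prems by (auto intro: times_differentiable_Suc_imp simp del: times_differentiable.simps)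
  then have "times_differentiable n (\<lambda>x. f' x * g x + g' x * f x)"
    using * by (intro times_differentiable_add Suc.IH)
  moreover have "((\<lambda>x. f x * g x) has_real_derivative f' x * g x + g' x * f x) (at x)" for x
    by (rule DERIV_mult *)+
  ultimately show ?case
    by (auto intro!: exI[of _ "\<lambda>x. f' x * g x + g' x * f x"])
qed simp

lemma smooth_add: "smooth f \<Longrightarrow> smooth g \<Longrightarrow> smooth (\<lambda>x. f x + g x)"
  and smooth_mult: "smooth f \<Longrightarrow> smooth g \<Longrightarrow> smooth (\<lambda>x. f x * g x)"
  by (auto simp: smooth_iff_times_differentiable times_differentiable_add times_differentiable_mult)

lemma smooth_const: "smooth (\<lambda>x. c)"
proof -
  have "times_differentiable n (\<lambda>x. c)" for n c
    by (induction n arbitrary: c) (auto intro!: exI[of _ "\<lambda>x. 0"])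
  then show ?thesis by (auto simp: smooth_iff_times_differentiable)
qed

lemma smooth_cmult: "smooth f \<Longrightarrow> smooth (\<lambda>x. c * f x)"
  by (intro smooth_mult smooth_const)

lemma smooth_diff: "smooth f \<Longrightarrow> smooth g \<Longrightarrow> smooth (\<lambda>x. f x - g x)"
  using smooth_add[OF _ smooth_cmult[of g "-1"], of f] by simp

lemma smooth_real_polynomial_function:
  fixes p :: "real \<Rightarrow> real"
  assumes "real_polynomial_function p" shows "smooth p"
proof -
  have "real_polynomial_function p \<Longrightarrow> times_differentiable n p" for n and p :: "real \<Rightarrow> real"
    by (induction n arbitrary: p) (use has_real_derivative_polynomial_function in force)+
  with assms show ?thesis by (auto simp: smooth_iff_times_differentiable)
qed

lemma smooth_affine:
  assumes "smooth f" shows "smooth (\<lambda>x. f (s * x + t))"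
proof -
  have "times_differentiable n f \<Longrightarrow> times_differentiable n (\<lambda>x. f (s * x + t))" for n
  proof (induction n arbitrary: f)
    case (Suc n)
    then obtain f' where f': "\<And>x. (f has_real_derivative f' x) (at x)" "times_differentiable n f'"
      by auto
    have "times_differentiable n (\<lambda>x. f' (s * x + t) * s)"
      using Suc.IH[OF f'(2)] smooth_const[of s]
      by (auto simp: smooth_iff_times_differentiable intro: times_differentiable_mult)
    moreover have "((\<lambda>x. f (s * x + t)) has_real_derivative f' (s * x + t) * s) (at x)" for x
      by (rule DERIV_chain2[OF f'(1)]) (auto intro!: derivative_eq_intros)
    ultimately show ?case
      by (auto intro!: exI[of _ "\<lambda>x. f' (s * x + t) * s"])
  qed simp
  with assms show ?thesis by (auto simp: smooth_iff_times_differentiable)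
qed

lemma funpow_deriv_add:
  "smooth f \<Longrightarrow> smooth g \<Longrightarrow>
    (deriv ^^ k) (\<lambda>x. f x + g x) = (\<lambda>x. (deriv ^^ k) f x + (deriv ^^ k) g x)"
proof (induction k arbitrary: f g)
  case (Suc k)
  have "deriv (\<lambda>x. f x + g x) = (\<lambda>x. deriv f x + deriv g x)"
    by (intro has_derivative_imp_deriv_eq DERIV_add smooth_has_derivative Suc.prems)
  then show ?case
    unfolding deriv_funpow_Suc using Suc by (simp add: smooth_deriv)
qed simp

lemma funpow_deriv_cmult:
  "smooth f \<Longrightarrow> (deriv ^^ k) (\<lambda>x. c * f x) = (\<lambda>x. c * (deriv ^^ k) f x)"
proof (induction k arbitrary: f)
  case (Suc k)
  have "deriv (\<lambda>x. c * f x) = (\<lambda>x. c * deriv f x)"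
    by (intro has_derivative_imp_deriv_eq DERIV_cmult smooth_has_derivative Suc.prems)
  then show ?case
    unfolding deriv_funpow_Suc using Suc by (simp add: smooth_deriv)
qed simp

lemma funpow_deriv_affine:
  "smooth f \<Longrightarrow> (deriv ^^ k) (\<lambda>x. f (s * x + t)) = (\<lambda>x. s ^ k * (deriv ^^ k) f (s * x + t))"
proof (induction k arbitrary: f)
  case (Suc k)
  have "deriv (\<lambda>x. f (s * x + t)) = (\<lambda>x. s * deriv f (s * x + t))"
  proof (intro has_derivative_imp_deriv_eq)
    show "((\<lambda>x. f (s * x + t)) has_real_derivative s * deriv f (s * x + t)) (at x)" for x
      by (rule DERIV_cong[OF DERIV_chain2[OF smooth_has_derivative[OF Suc.prems]]])
         (auto intro!: derivative_eq_intros)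
  qed
  then have "(deriv ^^ Suc k) (\<lambda>x. f (s * x + t)) = (deriv ^^ k) (\<lambda>x. s * deriv f (s * x + t))"
    by (simp add: deriv_funpow_Suc del: funpow.simps)
  also have "\<dots> = (\<lambda>x. s * (s ^ k * (deriv ^^ k) (deriv f) (s * x + t)))"
    by (subst funpow_deriv_cmult)
       (simp_all add: Suc.IH Suc.prems smooth_deriv smooth_affine)
  finally show ?case
    by (simp add: deriv_funpow_Suc mult.assoc del: funpow.simps)
qed simp

lemma funpow_deriv_zero_outside:
  assumes "closed S" "\<And>x. x \<notin> S \<Longrightarrow> f x = 0" "x \<notin> S"
  shows "(deriv ^^ k) f x = (0::real)"
  using assms(2,3)
proof (induction k arbitrary: x)
  case (Suc k)
  have "((deriv ^^ k) f has_real_derivative 0) (at x)"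
  proof (rule has_field_derivative_transform_within_open)
    show "((\<lambda>x. 0) has_real_derivative 0) (at x)" "open (- S)" "x \<in> - S"
      using assms Suc.prems by auto
  qed (use Suc in auto)
  then show ?case by (simp add: DERIV_imp_deriv)
qed simp

lemma tendsto_poly_times_exp_minus:
  "((\<lambda>y::real. poly P y * exp (- y)) \<longlongrightarrow> 0) at_top"
proof -
  have "((\<lambda>y. \<Sum>i\<le>degree P. coeff P i * (y ^ i / exp y)) \<longlongrightarrow> (\<Sum>i\<le>degree P. coeff P i * 0)) at_top"
    by (intro tendsto_intros tendsto_power_div_exp_0)
  then show ?thesis
    by (simp add: poly_altdef exp_minus sum_distrib_right divide_inverse mult.assoc)
qed

text \<open>
  The function \<open>exp (-1/x)\<close>, extended by \<open>0\<close>, together with polynomial factors in \<open>1/x\<close>: with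
  these factors the family is closed under differentiation, which makes all its members smooth.
\<close>

definition flat :: "real poly \<Rightarrow> real \<Rightarrow> real" where
  "flat P x = (if 0 < x then poly P (1 / x) * exp (- (1 / x)) else 0)"

lemma flat_has_derivative:
  "(flat P has_real_derivative flat ([:0, 0, 1:] * (P - pderiv P)) x) (at x)"
proof -
  consider "x > 0" | "x < 0" | "x = 0" by linarith
  then show ?thesis
  proof cases
    case 1
    have "((\<lambda>x. poly P (1 / x) * exp (- (1 / x))) has_real_derivative
            poly ([:0, 0, 1:] * (P - pderiv P)) (1 / x) * exp (- (1 / x))) (at x)"
      using 1 by (auto intro!: derivative_eq_intros DERIV_chain2[OF poly_DERIV]
                       simp: divide_simps power2_eq_square algebra_simps)
    then have "(flat P has_real_derivative
            poly ([:0, 0, 1:] * (P - pderiv P)) (1 / x) * exp (- (1 / x))) (at x)"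
      by (rule has_field_derivative_transform_within_open[of _ _ _ "{0<..}"])
         (use 1 in \<open>auto simp: flat_def\<close>)
    with 1 show ?thesis by (simp add: flat_def del: poly_mult)
  next
    case 2
    have "(flat P has_real_derivative 0) (at x)"
      by (rule has_field_derivative_transform_within_open[of "\<lambda>x. 0" _ _ "{..<0}"])
         (use 2 in \<open>auto simp: flat_def\<close>)
    with 2 show ?thesis by (simp add: flat_def)
  next
    case 3
    have "((\<lambda>h. flat P h / h) \<longlongrightarrow> 0) (at_right 0)"
      \<comment> \<open>With \<open>y = 1/h\<close> the difference quotient is \<open>y P(y) exp (-y)\<close>.\<close>
      unfolding filterlim_at_right_to_top
    proof (rule Lim_transform_eventually[OF tendsto_poly_times_exp_minus[of "pCons 0 P"]])
      show "\<forall>\<^sub>F y in at_top. poly (pCons 0 P) y * exp (- y) = flat P (inverse y) / inverse y"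
        using eventually_gt_at_top[of 0]
        by eventually_elim (simp add: flat_def divide_simps)
    qed
    moreover have "((\<lambda>h. flat P h / h) \<longlongrightarrow> 0) (at_left 0)"
      by (rule tendsto_eventually) (auto simp: flat_def eventually_at_filter)
    ultimately have "((\<lambda>h. flat P h / h) \<longlongrightarrow> 0) (at 0)"
      by (simp add: filterlim_split_at)
    with 3 show ?thesis
      by (simp add: DERIV_def flat_def)
  qed
qed

lemma smooth_flat: "smooth (flat P)"
proof -
  have "times_differentiable n (flat P)" for n
    by (induction n arbitrary: P) (use flat_has_derivative in auto)
  then show ?thesis by (auto simp: smooth_iff_times_differentiable)
qed

text \<open>
  The product of two flat functions, one starting at \<open>\<alpha>\<close> to the right and one at \<open>\<beta>\<close> to the left.
  Being positive inside the interval, it can be divided by there.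
\<close>

lemma smooth_bump_exists:
  fixes \<alpha> \<beta> :: real
  obtains b where "smooth b" "\<And>x. x \<in> {\<alpha><..<\<beta>} \<Longrightarrow> 0 < b x" "\<And>x. x \<notin> {\<alpha><..<\<beta>} \<Longrightarrow> b x = 0"
proof
  let ?b = "\<lambda>x. flat 1 (1 * x + (- \<alpha>)) * flat 1 (- 1 * x + \<beta>)"
  show "smooth ?b" by (intro smooth_mult smooth_affine smooth_flat)
qed (auto simp: flat_def)

section \<open>Smooth densities approximate bounded ones in weighted cost\<close>

definition cost :: "real \<Rightarrow> (real \<Rightarrow> real) \<Rightarrow> (real \<Rightarrow> real) \<Rightarrow> ennreal" where
  "cost p v u = (\<integral>\<^sup>+ x. ennreal (v x * \<bar>u x\<bar> powr p) \<partial>lborel)"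

definition moment :: "nat \<Rightarrow> (real \<Rightarrow> real) \<Rightarrow> real" where
  "moment m u = (LINT x|lborel. x ^ m * u x)"

text \<open>
  Demanding a compact interval inside \<open>(0, \<epsilon>)\<close> leaves room near \<open>0\<close> for the next bump.
\<close>

definition bump_in :: "real \<Rightarrow> (real \<Rightarrow> real) \<Rightarrow> bool" where
  "bump_in \<epsilon> u \<longleftrightarrow> smooth u \<and> (\<forall>x. 0 \<le> u x) \<and> 
     (\<exists>\<alpha> \<beta>. 0 < \<alpha> \<and> \<alpha> \<le> \<beta> \<and> \<beta> < \<epsilon> \<and> (\<forall>x. x \<notin> {\<alpha>..\<beta>} \<longrightarrow> u x = 0))"

lemma integrable_bounded_Icc:
  fixes f :: "real \<Rightarrow> real"
  assumes [measurable]: "f \<in> borel_measurable borel"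
    and "\<And>x. x \<in> {\<alpha>..\<beta>} \<Longrightarrow> \<bar>f x\<bar> \<le> B" "\<And>x. x \<notin> {\<alpha>..\<beta>} \<Longrightarrow> f x = 0"
  shows "integrable lborel f"
proof (rule Bochner_Integration.integrable_bound)
  show "integrable lborel (\<lambda>x. B * indicator {\<alpha>..\<beta>} x)"
    by (intro integrable_mult_right integrable_real_indicator) (auto simp: emeasure_lborel_Icc_eq)
  show "AE x in lborel. norm (f x) \<le> norm (B * indicator {\<alpha>..\<beta>} x)"
  proof (intro AE_I2)
    show "norm (f x) \<le> norm (B * indicator {\<alpha>..\<beta>} x)" for x
      using assms(2,3)[of x] by (cases "x \<in> {\<alpha>..\<beta>}") auto
  qed
qed simp

text \<open>
  Fix a smooth bump \<open>b\<close> that is positive on \<open>[\<alpha>, \<beta>]\<close>. Then \<open>g / b\<close> is bounded and measurable, hence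
  an almost everywhere limit of bounded continuous functions, which by Weierstrass may be taken to be
  polynomials that are non-negative on the support of \<open>b\<close>. Multiplying back by \<open>b\<close> gives
  uniformly bounded smooth functions converging to \<open>g\<close>, and dominated convergence (here the
  boundedness of \<open>v\<close> enters) carries over the moment and the cost.
\<close>

lemma smooth_approximation:
  assumes [measurable]: "v \<in> borel_measurable borel" "g \<in> borel_measurable borel"
    and v: "\<And>x. 0 \<le> v x" "\<And>x. v x \<le> M" and p: "0 < p"
    and g: "\<And>x. 0 \<le> g x" "\<And>x. g x \<le> B" "\<And>x. x \<notin> {\<alpha>..\<beta>} \<Longrightarrow> g x = 0"
    and ab: "0 < \<alpha>" "\<alpha> \<le> \<beta>" "\<beta> < \<epsilon>"
    and mom: "1 < moment m g" and cost: "cost p v g < \<eta>"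
  shows "\<exists>u. bump_in \<epsilon> u \<and> 1 \<le> moment m u \<and> cost p v u < \<eta>"
proof -
  define \<alpha>' \<beta>' where "\<alpha>' = \<alpha> / 2" and "\<beta>' = (\<beta> + \<epsilon>) / 2"
  have ab': "0 < \<alpha>'" "\<alpha>' < \<alpha>" "\<beta> < \<beta>'" "\<beta>' < \<epsilon>"
    using ab by (auto simp: \<alpha>'_def \<beta>'_def)
  obtain b where b: "smooth b" "\<And>x. x \<in> {\<alpha>'<..<\<beta>'} \<Longrightarrow> 0 < b x" "\<And>x. x \<notin> {\<alpha>'<..<\<beta>'} \<Longrightarrow> b x = 0"
    using smooth_bump_exists[of \<alpha>' \<beta>'] by blast
  have b0: "0 \<le> b x" for x
    using b(2,3)[of x] by (cases "x \<in> {\<alpha>'<..<\<beta>'}") auto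
  obtain z where z: "z \<in> {\<alpha>..\<beta>}" "\<And>x. x \<in> {\<alpha>..\<beta>} \<Longrightarrow> b z \<le> b x"
    using continuous_attains_inf[of "{\<alpha>..\<beta>}" b] ab smooth_continuous_on[OF b(1)] by auto
  have bz: "0 < b z" using z(1) ab' by (intro b(2)) auto
  obtain y where y: "y \<in> {\<alpha>'..\<beta>'}" "\<And>x. x \<in> {\<alpha>'..\<beta>'} \<Longrightarrow> b x \<le> b y"
    using continuous_attains_sup[of "{\<alpha>'..\<beta>'}" b] ab ab' smooth_continuous_on[OF b(1)] by auto
  have bmax: "b x \<le> b y" for x
    using y(2)[of x] b(3)[of x] b0[of y] by (cases "x \<in> {\<alpha>'..\<beta>'}") auto
  have [measurable]: "b \<in> borel_measurable borel" using b(1) by (rule smooth_borel)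
  define G where "G x = g x / b x" for x
  define C where "C = B / b z"
  have B0: "0 \<le> B" using g(1,2)[of 0] by simp
  have C0: "0 \<le> C" using bz B0 by (simp add: C_def)
  have G: "0 \<le> G x" "G x \<le> C" for x
  proof -
    show "0 \<le> G x" using g(1) b0 by (simp add: G_def)
    show "G x \<le> C"
    proof (cases "x \<in> {\<alpha>..\<beta>}")
      case True
      then show ?thesis unfolding G_def C_def using g(1,2)[of x] z(2)[of x] bz by (intro frac_le) auto
    qed (use g(3) C0 in \<open>auto simp: G_def\<close>)
  qed
  have bG: "b x * G x = g x" for x
    using b(2)[of x] g(3)[of x] ab' by (cases "x \<in> {\<alpha>..\<beta>}") (auto simp: G_def)
  have "G \<in> borel_measurable lborel" unfolding G_def by measurable
  then have "G measurable_on UNIV"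
    by (intro lebesgue_measurable_imp_measurable_on_real measurable_completion) auto
  then obtain N h where N: "negligible N" and h: "\<And>n. continuous_on UNIV (h n)"
    and lim_h: "\<And>x. x \<notin> N \<Longrightarrow> (\<lambda>n. h n x) \<longlonglongrightarrow> G x"
    unfolding measurable_on_def by auto
  \<comment> \<open>Clipping to the range of \<open>G\<close> keeps the limit and provides uniform bounds.\<close>
  define H where "H n x = max 0 (min C (h n x))" for n :: nat and x
  have H: "0 \<le> H n x" "H n x \<le> C" for n x
    using C0 by (auto simp: H_def)
  have lim_H: "(\<lambda>n. H n x) \<longlonglongrightarrow> G x" if "x \<notin> N" for x
  proof -
    have "(\<lambda>n. H n x) \<longlonglongrightarrow> max 0 (min C (G x))"
      unfolding H_def by (intro tendsto_intros lim_h that)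
    then show ?thesis using G[of x] by simp
  qed
  have "\<exists>P. real_polynomial_function P \<and> (\<forall>x\<in>{\<alpha>'..\<beta>'}. \<bar>H n x - P x\<bar> < 1 / Suc n)" for n
  proof -
    have "continuous_on {\<alpha>'..\<beta>'} (H n)"
      unfolding H_def by (intro continuous_intros continuous_on_subset[OF h]) auto
    from Stone_Weierstrass_real_polynomial_function[OF compact_Icc this, of "1 / Suc n"]
    show ?thesis by (metis of_nat_0_less_iff zero_less_Suc zero_less_divide_1_iff)
  qed
  then obtain P where P: "\<And>n. real_polynomial_function (P n)"
    and P_H: "\<And>n x. x \<in> {\<alpha>'..\<beta>'} \<Longrightarrow> \<bar>H n x - P n x\<bar> < 1 / Suc n"
    by metis
  \<comment> \<open>The shift by the approximation error keeps the polynomial factor non-negative.\<close>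
  define u where "u n x = b x * (P n x + 1 / Suc n)" for n x
  have smooth_u: "smooth (u n)" for n
    unfolding u_def
    by (intro smooth_mult smooth_add b smooth_real_polynomial_function P smooth_const)
  then have [measurable]: "u n \<in> borel_measurable borel" for n by (rule smooth_borel)
  define D where "D = b y * (C + 2)"
  have u: "0 \<le> u n x" "u n x \<le> D" for n x
  proof -
    have "0 \<le> u n x \<and> u n x \<le> D"
    proof (cases "x \<in> {\<alpha>'..\<beta>'}")
      case True
      have "1 / real (Suc n) \<le> 1" by simp
      then have "P n x + 1 / Suc n \<le> C + 2" "0 \<le> P n x + 1 / Suc n"
        using P_H[OF True, of n] H[of n x] by linarith+
      then show ?thesis
        unfolding u_def D_def using b0[of x] bmax[of x] by (auto intro!: mult_mono)
    next
      case False
      then show ?thesis using b(3)[of x] b0[of y] C0 by (auto simp: u_def D_def)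
    qed
    then show "0 \<le> u n x" "u n x \<le> D" by auto
  qed
  have u_out: "u n x = 0" if "x \<notin> {\<alpha>'..\<beta>'}" for n x
    using b(3)[of x] that by (auto simp: u_def)
  have bump: "bump_in \<epsilon> (u n)" for n
    unfolding bump_in_def
    by (intro conjI allI smooth_u u(1) exI[of _ \<alpha>'] exI[of _ \<beta>']) (use ab' ab u_out in auto)
  have lim_u: "(\<lambda>n. u n x) \<longlonglongrightarrow> g x" if "x \<notin> N" for x
  proof (cases "x \<in> {\<alpha>'..\<beta>'}")
    case True
    have "(\<lambda>n. P n x - H n x) \<longlonglongrightarrow> 0"
    proof (rule Lim_null_comparison[OF _ LIMSEQ_Suc[OF lim_1_over_n]])
      show "\<forall>\<^sub>F n in sequentially. norm (P n x - H n x) \<le> 1 / real (Suc n)"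
        using P_H[OF True] by (auto intro!: always_eventually simp: abs_minus_commute less_imp_le)
    qed
    from tendsto_add[OF tendsto_add[OF this lim_H[OF that]] LIMSEQ_Suc[OF lim_1_over_n]]
    have "(\<lambda>n. P n x + 1 / Suc n) \<longlonglongrightarrow> G x" by simp
    from tendsto_mult_left[OF this, of "b x"] show ?thesis
      by (simp add: u_def bG)
  next
    case False
    then show ?thesis using u_out[OF False] g(3)[of x] ab' by auto
  qed
  have AE: "AE x in lborel. x \<notin> N"
    using AE_not_in[OF N[unfolded negligible_iff_null_sets]] unfolding AE_completion_iff .
  have "(\<lambda>n. moment m (u n)) \<longlonglongrightarrow> moment m g"
    unfolding moment_def
  proof (rule integral_dominated_convergence)
    show "integrable lborel (\<lambda>x. \<epsilon> ^ m * D * indicator {\<alpha>'..\<beta>'} x)"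
      by (intro integrable_mult_right integrable_real_indicator) (auto simp: emeasure_lborel_Icc_eq)
    show "AE x in lborel. (\<lambda>n. x ^ m * u n x) \<longlonglongrightarrow> x ^ m * g x"
      using AE by eventually_elim (intro tendsto_mult_left lim_u)
    show "AE x in lborel. norm (x ^ m * u n x) \<le> \<epsilon> ^ m * D * indicator {\<alpha>'..\<beta>'} x" for n
    proof (intro AE_I2)
      fix x
      show "norm (x ^ m * u n x) \<le> \<epsilon> ^ m * D * indicator {\<alpha>'..\<beta>'} x"
      proof (cases "x \<in> {\<alpha>'..\<beta>'}")
        case True
        then show ?thesis using u[of n x] ab'
          by (auto simp: abs_mult power_abs intro!: mult_mono power_mono)
      qed (use u_out in auto)
    qed
  qed auto
  then have ev1: "\<forall>\<^sub>F n in sequentially. 1 < moment m (u n)"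
    using mom by (rule order_tendstoD)
  have "(\<lambda>n. cost p v (u n)) \<longlonglongrightarrow> cost p v g"
    unfolding cost_def
  proof (rule nn_integral_dominated_convergence)
    show "(\<integral>\<^sup>+ x. ennreal (M * D powr p) * indicator {\<alpha>'..\<beta>'} x \<partial>lborel) < \<infinity>"
      using ab ab' by (simp add: nn_integral_cmult_indicator ennreal_mult_less_top)
    show "AE x in lborel. (\<lambda>n. ennreal (v x * \<bar>u n x\<bar> powr p)) \<longlonglongrightarrow> ennreal (v x * \<bar>g x\<bar> powr p)"
      using AE
    proof eventually_elim
      case (elim x)
      show ?case using p
        by (intro tendsto_ennrealI tendsto_mult_left tendsto_powr' tendsto_rabs lim_u elim tendsto_const) auto
    qed
    show "AE x in lborel. ennreal (v x * \<bar>u n x\<bar> powr p) \<le> ennreal (M * D powr p) * indicator {\<alpha>'..\<beta>'} x" for n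
    proof (intro AE_I2)
      fix x
      show "ennreal (v x * \<bar>u n x\<bar> powr p) \<le> ennreal (M * D powr p) * indicator {\<alpha>'..\<beta>'} x"
      proof (cases "x \<in> {\<alpha>'..\<beta>'}")
        case True
        then show ?thesis using u[of n x] v[of x] p
          by (auto intro!: ennreal_leI mult_mono powr_mono2)
      qed (use u_out in auto)
    qed
  qed auto
  then have ev2: "\<forall>\<^sub>F n in sequentially. cost p v (u n) < \<eta>"
    using cost by (rule order_tendstoD)
  from eventually_conj[OF ev1 ev2] obtain n where "1 < moment m (u n)" "cost p v (u n) < \<eta>"
    by (auto simp: eventually_sequentially)
  with bump[of n] show ?thesis by (intro exI[of _ "u n"]) auto
qed

section \<open>Criticality produces bounded densities of small cost\<close>

text \<open>
  One-sided criticality of order \<open>m\<close> at \<open>0\<close> with respect to Lebesgue measure. For \<open>p = 1\<close> the infinite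
  essential supremum of \<open>x\<^sup>m / v\<close> is spelled out by its superlevel sets, multiplied out so that zeros
  of \<open>v\<close> need no convention.
\<close>

definition critical_at_0 :: "real \<Rightarrow> nat \<Rightarrow> (real \<Rightarrow> real) \<Rightarrow> bool" where
  "critical_at_0 p m v \<longleftrightarrow> (\<forall>\<epsilon>>0.
     if p = 1 then \<forall>K>0. 0 < emeasure lborel {x \<in> {0<..<\<epsilon>}. K * v x < x ^ m}
     else (\<integral>\<^sup>+ x\<in>{0<..<\<epsilon>}.
       epowr (ennreal (x ^ m) / epowr (ennreal (v x)) (1 / p)) (holder_conjugate p) \<partial>lborel) = \<infinity>)"

lemma exhaust_Ioo:
  fixes x :: real
  assumes "x \<in> {0<..<\<epsilon>}"
  shows "\<forall>\<^sub>F i in sequentially. x \<in> {1 / Suc i..\<epsilon> - 1 / Suc i}"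
proof -
  have "(\<lambda>i. 1 / real (Suc i)) \<longlonglongrightarrow> 0" by (rule LIMSEQ_Suc[OF lim_1_over_n])
  then have "\<forall>\<^sub>F i in sequentially. 1 / Suc i < min x (\<epsilon> - x)"
    using assms by (intro order_tendstoD) auto
  then show ?thesis by eventually_elim auto
qed

text \<open>
  Since \<open>p' = 1 + r\<close> and \<open>p' / p = r\<close>, the integrand that defines criticality is
  \<open>y \<sqdot> (y / v) powr r\<close> when \<open>v > 0\<close>. Adding \<open>1 / Suc i\<close> to \<open>v\<close> gives finite approximations, which tend
  to \<open>\<infinity>\<close> where \<open>v = 0\<close>.
\<close>

lemma dual_density_limit:
  fixes p v y :: real
  assumes p: "1 < p" and v: "0 \<le> v" and y: "0 < y" and r: "r = 1 / (p - 1)"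
  shows "(\<lambda>i. ennreal (y * (y / (v + 1 / Suc i)) powr r)) \<longlonglongrightarrow>
     epowr (ennreal y / epowr (ennreal v) (1 / p)) (holder_conjugate p)"
proof (cases "v = 0")
  case True
  have r0: "0 < r" using p r by simp
  have "filterlim (\<lambda>i::nat. y * (y / (0 + 1 / Suc i)) powr r) at_top sequentially"
  proof -
    have "filterlim (\<lambda>i::nat. y * (y * (1 + real i)) powr r) at_top sequentially"
      using r0 y by real_asymp
    then show ?thesis by (simp add: field_simps)
  qed
  then have "(\<lambda>i. ennreal (y * (y / (0 + 1 / Suc i)) powr r)) \<longlonglongrightarrow> top"
    by (simp only: ennreal_tendsto_top_eq_at_top)
  then show ?thesis using True p y
    by (simp add: epowr_def ennreal_divide_zero)
next
  case False
  then have v0: "0 < v" using v by simp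
  define q where "q = holder_conjugate p"
  have q: "q = 1 + r" "(1 / p) * q = r"
    using p r by (auto simp: q_def holder_conjugate_def field_simps)
  have "epowr (ennreal y / epowr (ennreal v) (1 / p)) q = ennreal ((y / v powr (1 / p)) powr q)"
    using v0 y by (simp add: epowr_def divide_ennreal)
  also have "(y / v powr (1 / p)) powr q = y powr (1 + r) / v powr r"
    using v0 y q by (simp add: powr_divide powr_powr)
  also have "\<dots> = y * (y / v) powr r"
    using v0 y by (simp add: powr_divide powr_add)
  finally have eq: "epowr (ennreal y / epowr (ennreal v) (1 / p)) q = ennreal (y * (y / v) powr r)" .
  have "(\<lambda>i. y * (y / (v + 1 / Suc i)) powr r) \<longlonglongrightarrow> y * (y / (v + 0)) powr r"
    using v0 y by (intro tendsto_intros LIMSEQ_Suc[OF lim_1_over_n]) auto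
  then show ?thesis
    unfolding eq[unfolded q_def] by (intro tendsto_ennrealI) simp
qed

text \<open>
  Let \<open>\<rho> = (x\<^sup>m / (v + 1/n)) powr r\<close> with \<open>r = 1 / (p - 1)\<close>, cut off to \<open>[1/n, \<epsilon> - 1/n]\<close>, and let \<open>F\<close> be its
  \<open>m\<close>-th moment. As \<open>\<rho> powr (p - 1) = x\<^sup>m / (v + 1/n)\<close>, the cost of \<open>\<rho>\<close> is at most \<open>F\<close>, so that
  \<open>2 \<rho> / F\<close> has moment \<open>2\<close> and cost at most \<open>2 powr p \<sqdot> F powr (1 - p)\<close>. By monotone convergence and
  criticality \<open>F\<close> is as large as desired.
\<close>

lemma bounded_density_gt_1:
  assumes [measurable]: "v \<in> borel_measurable borel" and v: "\<And>x. 0 \<le> v x"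
    and p: "1 < p" and crit: "critical_at_0 p m v" and \<epsilon>: "0 < \<epsilon>" and \<eta>: "0 < \<eta>"
  shows "\<exists>g \<in> borel_measurable borel. \<exists>B \<alpha> \<beta>. 0 < \<alpha> \<and> \<alpha> \<le> \<beta> \<and> \<beta> < \<epsilon> \<and>
    (\<forall>x. 0 \<le> g x \<and> g x \<le> B) \<and> (\<forall>x. x \<notin> {\<alpha>..\<beta>} \<longrightarrow> g x = 0) \<and>
    1 < moment m g \<and> cost p v g < ennreal \<eta>"
proof -
  define r where "r = 1 / (p - 1)"
  have r0: "0 < r" using p by (simp add: r_def)
  define E where "E i = {1 / real (Suc i)..\<epsilon> - 1 / real (Suc i)}" for i :: nat
  define \<rho> where "\<rho> i x = indicator (E i) x * (x ^ m / (v x + 1 / Suc i)) powr r" for i x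
  have [measurable]: "E i \<in> sets borel" for i by (simp add: E_def)
  have [measurable]: "\<rho> i \<in> borel_measurable borel" for i
    unfolding \<rho>_def by measurable
  have E_pos: "0 < x" "x < \<epsilon>" if "x \<in> E i" for i x
  proof -
    have "0 < 1 / real (Suc i)" by simp
    then show "0 < x" "x < \<epsilon>" using that unfolding E_def atLeastAtMost_iff by linarith+
  qed
  have vn: "0 < v x + 1 / Suc i" for x i using v[of x] by (simp add: add_nonneg_pos)
  have mono: "x ^ m * \<rho> i x \<le> x ^ m * \<rho> j x" if "i \<le> j" for i j x
  proof (cases "x \<in> E i")
    case True
    have le: "1 / real (Suc j) \<le> 1 / real (Suc i)" using that by (intro frac_le) auto
    then have "x \<in> E j" using True unfolding E_def by auto
    moreover have "x ^ m / (v x + 1 / Suc i) \<le> x ^ m / (v x + 1 / Suc j)"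
      using E_pos[OF True] vn[of x] le by (intro frac_le) auto
    ultimately show ?thesis
      using E_pos[OF True] True vn[of x i] r0 by (auto simp: \<rho>_def intro!: mult_left_mono powr_mono2)
  next
    case False
    show ?thesis
    proof (cases "x \<in> E j")
      case True
      then show ?thesis using E_pos[OF True] False by (simp add: \<rho>_def)
    qed (use False in \<open>auto simp: \<rho>_def\<close>)
  qed
  have "(\<integral>\<^sup>+ x\<in>{0<..<\<epsilon>}.
       epowr (ennreal (x ^ m) / epowr (ennreal (v x)) (1 / p)) (holder_conjugate p) \<partial>lborel)
     \<le> (\<integral>\<^sup>+ x. (SUP i. ennreal (x ^ m * \<rho> i x)) \<partial>lborel)"
  proof (intro nn_integral_mono)
    fix x
    show "epowr (ennreal (x ^ m) / epowr (ennreal (v x)) (1 / p)) (holder_conjugate p) * indicator {0<..<\<epsilon>} x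
      \<le> (SUP i. ennreal (x ^ m * \<rho> i x))"
    proof (cases "x \<in> {0<..<\<epsilon>}")
      case True
      then have "0 < x ^ m" by simp
      have ev: "\<forall>\<^sub>F i in sequentially. ennreal (x ^ m * (x ^ m / (v x + 1 / Suc i)) powr r) = ennreal (x ^ m * \<rho> i x)"
        using exhaust_Ioo[OF True] by eventually_elim (simp add: \<rho>_def E_def)
      have "(\<lambda>i. ennreal (x ^ m * \<rho> i x)) \<longlonglongrightarrow>
        epowr (ennreal (x ^ m) / epowr (ennreal (v x)) (1 / p)) (holder_conjugate p)"
        by (rule Lim_transform_eventually[OF dual_density_limit[OF p v \<open>0 < x ^ m\<close> r_def] ev])
      then have "epowr (ennreal (x ^ m) / epowr (ennreal (v x)) (1 / p)) (holder_conjugate p) \<le> (SUP i. ennreal (x ^ m * \<rho> i x))"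
        by (rule LIMSEQ_le_const2) (auto intro!: SUP_upper)
      with True show ?thesis by simp
    qed simp
  qed
  also have "\<dots> = (SUP i. \<integral>\<^sup>+ x. ennreal (x ^ m * \<rho> i x) \<partial>lborel)"
    by (intro nn_integral_monotone_convergence_SUP)
       (auto simp: incseq_def le_fun_def intro!: ennreal_leI mono)
  finally have SUP: "(SUP i. \<integral>\<^sup>+ x. ennreal (x ^ m * \<rho> i x) \<partial>lborel) = \<infinity>"
    using crit p \<epsilon> by (simp add: critical_at_0_def top_unique)
  \<comment> \<open>The value of \<open>F\<close> at which \<open>2 powr p \<sqdot> F powr (1 - p)\<close> equals \<open>\<eta>\<close>.\<close>
  define K where "K = (2 powr p / \<eta>) powr r"
  have K0: "0 < K" using \<eta> by (simp add: K_def)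
  have "ennreal K < (SUP i. \<integral>\<^sup>+ x. ennreal (x ^ m * \<rho> i x) \<partial>lborel)"
    unfolding SUP by simp
  then obtain i where i: "ennreal K < (\<integral>\<^sup>+ x. ennreal (x ^ m * \<rho> i x) \<partial>lborel)"
    by (auto simp: less_SUP_iff)
  define B where "B = (\<epsilon> ^ m * Suc i) powr r"
  have \<rho>: "0 \<le> \<rho> i x" "\<rho> i x \<le> B" for x
  proof -
    show "0 \<le> \<rho> i x" by (simp add: \<rho>_def)
    show "\<rho> i x \<le> B"
    proof (cases "x \<in> E i")
      case True
      have "x ^ m / (v x + 1 / Suc i) \<le> \<epsilon> ^ m / (1 / Suc i)"
        using E_pos[OF True] v[of x] by (intro frac_le power_mono) auto
      then show ?thesis
        using True E_pos[OF True] vn[of x i] r0 by (auto simp: \<rho>_def B_def intro!: powr_mono2)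
    qed (simp add: \<rho>_def B_def)
  qed
  have \<rho>_out: "\<rho> i x = 0" if "x \<notin> E i" for x using that by (simp add: \<rho>_def)
  have nonneg: "0 \<le> x ^ m * \<rho> i x" for x
  proof (cases "x \<in> E i")
    case True
    then show ?thesis using E_pos[OF True] \<rho>(1)[of x] by simp
  qed (simp add: \<rho>_out)
  have int: "integrable lborel (\<lambda>x. x ^ m * \<rho> i x)"
  proof (rule integrable_bounded_Icc)
    show "\<bar>x ^ m * \<rho> i x\<bar> \<le> \<epsilon> ^ m * B" if "x \<in> {1 / real (Suc i)..\<epsilon> - 1 / real (Suc i)}" for x
      using E_pos[of x i] that \<rho>[of x] unfolding E_def[symmetric]
      by (auto simp: abs_mult power_abs intro!: mult_mono power_mono)
  qed (auto simp: \<rho>_out E_def)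
  define F where "F = moment m (\<rho> i)"
  have F: "(\<integral>\<^sup>+ x. ennreal (x ^ m * \<rho> i x) \<partial>lborel) = ennreal F"
    unfolding F_def moment_def by (rule nn_integral_eq_integral[OF int]) (simp add: nonneg)
  have KF: "K < F" using i K0 unfolding F by (simp add: ennreal_less_iff)
  define g where "g x = 2 / F * \<rho> i x" for x
  have [measurable]: "g \<in> borel_measurable borel" unfolding g_def by measurable
  have "moment m g = 2 / F * moment m (\<rho> i)"
    unfolding moment_def g_def by (simp add: mult.left_commute flip: integral_mult_right_zero)
  also have "\<dots> = 2" using KF K0 by (simp add: F_def[symmetric])
  finally have mom: "1 < moment m g" by simp
  have pw: "v x * \<bar>g x\<bar> powr p \<le> (2 / F) powr p * (x ^ m * \<rho> i x)" for x
  proof (cases "x \<in> E i")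
    case True
    let ?y = "x ^ m" and ?vn = "v x + 1 / Suc i"
    have y: "0 < ?y" using E_pos[OF True] by simp
    have \<rho>_eq: "\<rho> i x = (?y / ?vn) powr r" using True by (simp add: \<rho>_def)
    have "\<rho> i x powr p = (?y / ?vn) powr (r + 1)"
      unfolding \<rho>_eq powr_powr using p by (simp add: r_def field_simps)
    also have "\<dots> = \<rho> i x * (?y / ?vn)"
      using y vn[of x i] by (simp add: powr_add \<rho>_eq)
    finally have "v x * \<rho> i x powr p = (v x / ?vn) * (?y * \<rho> i x)" by simp
    also have "\<dots> \<le> 1 * (?y * \<rho> i x)"
      using y vn[of x i] \<rho>(1)[of x] v[of x] by (intro mult_right_mono) (auto simp: divide_le_eq)
    finally have *: "v x * \<rho> i x powr p \<le> x ^ m * \<rho> i x" by simp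
    have "\<bar>g x\<bar> = 2 / F * \<rho> i x"
      using KF K0 \<rho>(1)[of x] by (simp add: g_def)
    then have "v x * \<bar>g x\<bar> powr p = (2 / F) powr p * (v x * \<rho> i x powr p)"
      using KF K0 \<rho>(1)[of x] by (simp only: powr_mult mult.left_commute)
    also have "\<dots> \<le> (2 / F) powr p * (x ^ m * \<rho> i x)"
      by (intro mult_left_mono *) auto
    finally show ?thesis .
  qed (use p in \<open>simp add: g_def \<rho>_out\<close>)
  have "cost p v g \<le> (\<integral>\<^sup>+ x. ennreal ((2 / F) powr p) * ennreal (x ^ m * \<rho> i x) \<partial>lborel)"
    unfolding cost_def
    by (intro nn_integral_mono) (simp add: ennreal_mult'[symmetric] ennreal_leI pw)
  also have "\<dots> = ennreal ((2 / F) powr p * F)"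
    using KF K0 by (simp add: nn_integral_cmult F ennreal_mult)
  also have "(2 / F) powr p * F = 2 powr p * F powr (1 - p)"
    using KF K0 by (simp add: powr_divide powr_diff)
  also have "ennreal \<dots> < ennreal \<eta>"
  proof (rule ennreal_lessI[OF \<eta>])
    have "F powr (1 - p) < K powr (1 - p)"
      using KF K0 p by (intro powr_less_mono2_neg) auto
    also have "\<dots> = \<eta> / 2 powr p"
    proof -
      have "r * (1 - p) = - 1" using p by (simp add: r_def field_simps)
      then show ?thesis using \<eta> by (simp add: K_def powr_powr powr_minus_divide)
    qed
    finally show "2 powr p * F powr (1 - p) < \<eta>" by (simp add: field_simps)
  qed
  finally have cost: "cost p v g < ennreal \<eta>" .
  have "E i \<noteq> {}"
  proof
    assume "E i = {}"
    then have "F = 0" by (simp add: F_def moment_def \<rho>_def)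
    with KF K0 show False by simp
  qed
  then have "1 / real (Suc i) \<le> \<epsilon> - 1 / Suc i" by (simp add: E_def)
  moreover have "0 < 1 / real (Suc i)" "\<epsilon> - 1 / Suc i < \<epsilon>" by auto
  moreover have "0 \<le> g x \<and> g x \<le> 2 / F * B" for x
    unfolding g_def using KF K0 \<rho>[of x] by (intro conjI mult_left_mono mult_nonneg_nonneg) auto
  moreover have "g x = 0" if "x \<notin> {1 / real (Suc i)..\<epsilon> - 1 / Suc i}" for x
    using that \<rho>_out[of x] by (simp add: g_def E_def)
  ultimately show ?thesis using mom cost \<open>g \<in> borel_measurable borel\<close> by blast
qed

text \<open>
  On the set where \<open>K \<sqdot> v < x\<^sup>m\<close> the cost of an indicator is at most its \<open>m\<close>-th moment divided by \<open>K\<close>.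
  This set has positive measure, and so has its part in some compact subinterval.
\<close>

lemma bounded_density_eq_1:
  assumes [measurable]: "v \<in> borel_measurable borel" and v: "\<And>x. 0 \<le> v x"
    and crit: "critical_at_0 1 m v" and \<epsilon>: "0 < \<epsilon>" and \<eta>: "0 < \<eta>"
  shows "\<exists>g \<in> borel_measurable borel. \<exists>B \<alpha> \<beta>. 0 < \<alpha> \<and> \<alpha> \<le> \<beta> \<and> \<beta> < \<epsilon> \<and>
    (\<forall>x. 0 \<le> g x \<and> g x \<le> B) \<and> (\<forall>x. x \<notin> {\<alpha>..\<beta>} \<longrightarrow> g x = 0) \<and>
    1 < moment m g \<and> cost 1 v g < ennreal \<eta>"
proof -
  \<comment> \<open>Normalising the moment to \<open>2\<close> gives cost at most \<open>2 / K = \<eta> / 2\<close>.\<close>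
  define K where "K = 4 / \<eta>"
  have K0: "0 < K" using \<eta> by (simp add: K_def)
  define S where "S = {x \<in> {0<..<\<epsilon>}. K * v x < x ^ m}"
  define E where "E i = {1 / real (Suc i)..\<epsilon> - 1 / real (Suc i)}" for i :: nat
  have [measurable]: "S \<in> sets borel" "E i \<in> sets borel" for i
    unfolding S_def E_def by measurable
  have S_pos: "0 < emeasure lborel S"
    using crit \<epsilon> K0 by (simp add: critical_at_0_def S_def)
  have "S \<subseteq> (\<Union>i. S \<inter> E i)"
  proof
    fix x assume x: "x \<in> S"
    then have "x \<in> {0<..<\<epsilon>}" by (simp add: S_def)
    from exhaust_Ioo[OF this] obtain i where "x \<in> E i"
      unfolding E_def eventually_sequentially by blast
    with x show "x \<in> (\<Union>i. S \<inter> E i)" by auto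
  qed
  then have "S = (\<Union>i. S \<inter> E i)" by auto
  then have "\<exists>i. emeasure lborel (S \<inter> E i) \<noteq> 0"
    using S_pos emeasure_UN_eq_0[of lborel "\<lambda>i. S \<inter> E i"] by fastforce
  then obtain i where i: "emeasure lborel (S \<inter> E i) \<noteq> 0" by blast
  define T where "T = S \<inter> E i"
  have [measurable]: "T \<in> sets borel" by (simp add: T_def)
  have T: "0 < x" "x < \<epsilon>" "K * v x < x ^ m" "x \<in> E i" if "x \<in> T" for x
    using that by (auto simp: T_def S_def)
  have int: "integrable lborel (\<lambda>x. x ^ m * indicator T x)"
  proof (rule integrable_bounded_Icc)
    show "\<bar>x ^ m * indicator T x\<bar> \<le> \<epsilon> ^ m" for x
      using T[of x] \<epsilon> by (cases "x \<in> T") (auto simp: power_abs intro!: power_mono)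
    show "x ^ m * indicator T x = 0" if "x \<notin> {1 / real (Suc i)..\<epsilon> - 1 / real (Suc i)}" for x
      using that T(4)[of x] by (auto simp: E_def indicator_def)
  qed simp
  define \<mu> where "\<mu> = moment m (indicator T)"
  have nonneg: "0 \<le> x ^ m * indicator T x" for x using T(1)[of x] by (auto simp: indicator_def)
  have nn: "(\<integral>\<^sup>+ x. ennreal (x ^ m * indicator T x) \<partial>lborel) = ennreal \<mu>"
    unfolding \<mu>_def moment_def by (rule nn_integral_eq_integral[OF int]) (simp add: nonneg)
  have "(\<integral>\<^sup>+ x. ennreal (x ^ m * indicator T x) \<partial>lborel) \<noteq> 0"
  proof
    assume "(\<integral>\<^sup>+ x. ennreal (x ^ m * indicator T x) \<partial>lborel) = 0"
    then have "AE x in lborel. x ^ m * indicator T x \<le> 0"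
      by (subst (asm) nn_integral_0_iff_AE) (auto simp: ennreal_eq_0_iff)
    then have "AE x in lborel. x \<notin> T"
      by eventually_elim (use T(1) in \<open>force simp: indicator_def dest: zero_less_power[of _ m]\<close>)
    then have "emeasure lborel T = 0"
      by (subst (asm) AE_iff_measurable[of T]) auto
    with i show False by (simp add: T_def)
  qed
  then have \<mu>: "0 < \<mu>" unfolding nn by (simp add: ennreal_eq_0_iff not_le)
  define g where "g x = 2 / \<mu> * indicator T x" for x :: real
  have [measurable]: "g \<in> borel_measurable borel" unfolding g_def by measurable
  have "moment m g = 2 / \<mu> * moment m (indicator T)"
    unfolding moment_def g_def by (simp add: mult.left_commute flip: integral_mult_right_zero)
  also have "\<dots> = 2" using \<mu> by (simp add: \<mu>_def[symmetric])
  finally have mom: "1 < moment m g" by simp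
  have pw: "v x * \<bar>g x\<bar> powr 1 \<le> 2 / (\<mu> * K) * (x ^ m * indicator T x)" for x
    using T(3)[of x] \<mu> K0 v[of x] by (cases "x \<in> T") (auto simp: g_def field_simps less_imp_le)
  have "cost 1 v g \<le> (\<integral>\<^sup>+ x. ennreal (2 / (\<mu> * K)) * ennreal (x ^ m * indicator T x) \<partial>lborel)"
    unfolding cost_def using \<mu> K0 pw
    by (intro nn_integral_mono) (simp add: ennreal_mult'[symmetric] ennreal_leI)
  also have "\<dots> = ennreal (2 / (\<mu> * K) * \<mu>)"
    using \<mu> K0 by (simp add: nn_integral_cmult nn flip: ennreal_mult)
  also have "\<dots> < ennreal \<eta>"
    using \<mu> \<eta> by (intro ennreal_lessI) (auto simp: K_def)
  finally have cost: "cost 1 v g < ennreal \<eta>" .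
  have "T \<noteq> {}" using i by (auto simp: T_def)
  then have "1 / real (Suc i) \<le> \<epsilon> - 1 / Suc i" using T(4) unfolding E_def by fastforce
  moreover have "0 < 1 / real (Suc i)" "\<epsilon> - 1 / Suc i < \<epsilon>" by auto
  moreover have "0 \<le> g x \<and> g x \<le> 2 / \<mu>" for x
    unfolding g_def using \<mu> by (auto simp: indicator_def)
  moreover have "g x = 0" if "x \<notin> {1 / real (Suc i)..\<epsilon> - 1 / Suc i}" for x
    using that T(4)[of x] by (auto simp: g_def E_def indicator_def)
  ultimately show ?thesis using mom cost \<open>g \<in> borel_measurable borel\<close> by blast
qed

section \<open>Trading a moment for a derivative\<close>

text \<open>
  The statement \<open>A(k, m)\<close> of the introduction.
\<close>

definition cheap :: "real \<Rightarrow> (real \<Rightarrow> real) \<Rightarrow> nat \<Rightarrow> nat \<Rightarrow> bool" where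
  "cheap p v k m \<longleftrightarrow> (\<forall>\<epsilon>>0. \<forall>\<eta>>0. \<exists>u. bump_in \<epsilon> u \<and> 1 \<le> moment m u \<and>
     cost p v ((deriv ^^ k) u) < ennreal \<eta>)"

lemma cheap_0_of_critical:
  assumes v: "v \<in> borel_measurable borel" "\<And>x. 0 \<le> v x" "\<And>x. v x \<le> M" and p: "1 \<le> p"
    and crit: "critical_at_0 p m v"
  shows "cheap p v 0 m"
  unfolding cheap_def
proof (intro allI impI)
  fix \<epsilon> \<eta> :: real assume \<epsilon>: "0 < \<epsilon>" and \<eta>: "0 < \<eta>"
  have "\<exists>g \<in> borel_measurable borel. \<exists>B \<alpha> \<beta>. 0 < \<alpha> \<and> \<alpha> \<le> \<beta> \<and> \<beta> < \<epsilon> \<and>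
    (\<forall>x. 0 \<le> g x \<and> g x \<le> B) \<and> (\<forall>x. x \<notin> {\<alpha>..\<beta>} \<longrightarrow> g x = 0) \<and>
    1 < moment m g \<and> cost p v g < ennreal \<eta>"
  proof (cases "p = 1")
    case True
    with bounded_density_eq_1[OF v(1,2) _ \<epsilon> \<eta>] crit show ?thesis by simp
  next
    case False
    with p have "1 < p" by simp
    from bounded_density_gt_1[OF v(1,2) this crit \<epsilon> \<eta>] show ?thesis .
  qed
  then obtain g B \<alpha> \<beta> where "g \<in> borel_measurable borel" "0 < \<alpha>" "\<alpha> \<le> \<beta>" "\<beta> < \<epsilon>"
    "\<And>x. 0 \<le> g x" "\<And>x. g x \<le> B" "\<And>x. x \<notin> {\<alpha>..\<beta>} \<Longrightarrow> g x = 0"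
    "1 < moment m g" "cost p v g < ennreal \<eta>" by blast
  with smooth_approximation[of v g M p B \<alpha> \<beta> \<epsilon> m "ennreal \<eta>"] v p
  show "\<exists>u. bump_in \<epsilon> u \<and> 1 \<le> moment m u \<and> cost p v ((deriv ^^ 0) u) < ennreal \<eta>"
    by simp
qed

lemma bump_in_mono: "bump_in \<delta> u \<Longrightarrow> \<delta> \<le> \<epsilon> \<Longrightarrow> bump_in \<epsilon> u"
  unfolding bump_in_def by (meson less_le_trans)

lemma bump_in_nonneg: "bump_in \<epsilon> u \<Longrightarrow> 0 \<le> u x"
  and bump_in_smooth: "bump_in \<epsilon> u \<Longrightarrow> smooth u"
  by (auto simp: bump_in_def)

lemma bump_in_zero: "bump_in \<epsilon> u \<Longrightarrow> x \<notin> {0<..<\<epsilon>} \<Longrightarrow> u x = 0"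
  unfolding bump_in_def by (metis atLeastAtMost_iff greaterThanLessThan_iff less_le_trans le_less_trans)

lemma integrable_moment:
  assumes "bump_in \<epsilon> u" shows "integrable lborel (\<lambda>x. x ^ m * u x)"
proof -
  have cont: "continuous_on {0..\<epsilon>} (\<lambda>x. x ^ m * u x)"
    using assms by (intro continuous_intros smooth_continuous_on bump_in_smooth)
  then have "bounded ((\<lambda>x. x ^ m * u x) ` {0..\<epsilon>})"
    by (intro compact_imp_bounded compact_continuous_image) auto
  then obtain B where "\<And>x. x \<in> {0..\<epsilon>} \<Longrightarrow> \<bar>x ^ m * u x\<bar> \<le> B"
    unfolding bounded_iff by (metis image_eqI real_norm_def)
  moreover have [measurable]: "u \<in> borel_measurable borel"
    using assms by (intro smooth_borel bump_in_smooth)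
  moreover have "x ^ m * u x = 0" if "x \<notin> {0..\<epsilon>}" for x
    using bump_in_zero[OF assms, of x] that by auto
  ultimately show ?thesis
    by (intro integrable_bounded_Icc[of _ 0 \<epsilon> B]) auto
qed

lemma integral_eq_antiderivative_diff:
  fixes f F :: "real \<Rightarrow> real"
  assumes "a \<le> b" "\<And>x. (F has_real_derivative f x) (at x)" "\<And>x. isCont f x"
    "\<And>x. x \<notin> {a..b} \<Longrightarrow> f x = 0"
  shows "(LINT x|lborel. f x) = F b - F a"
proof -
  have "(LINT x|lborel. f x * indicator {a..b} x) = F b - F a"
    using assms by (intro integral_FTC_Icc_real) auto
  moreover have "f x * indicator {a..b} x = f x" for x
    using assms(4)[of x] by (auto simp: indicator_def)
  ultimately show ?thesis by simp
qed

text \<open>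
  Close to \<open>0\<close>, moments of higher order are negligible. This is why a correction made near \<open>0\<close> can
  repair the integral without spoiling the higher moments.
\<close>

lemma moment_Suc_le:
  assumes u: "bump_in \<delta> u" and \<delta>: "\<delta> \<le> 1"
  shows "moment (Suc m) u \<le> \<delta> * moment m u"
proof -
  have "x ^ Suc m * u x \<le> \<delta> * (x ^ m * u x)" for x
  proof (cases "x \<in> {0<..<\<delta>}")
    case True
    then have "x * (x ^ m * u x) \<le> \<delta> * (x ^ m * u x)"
      using bump_in_nonneg[OF u] by (intro mult_right_mono) auto
    then show ?thesis by (simp add: mult.assoc)
  qed (simp add: bump_in_zero[OF u])
  then have "moment (Suc m) u \<le> (LINT x|lborel. \<delta> * (x ^ m * u x))"
    unfolding moment_def
    by (intro integral_mono integrable_mult_right integrable_moment[OF u])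
  then show ?thesis by (simp add: moment_def)
qed

lemma moment_nonneg:
  assumes u: "bump_in \<epsilon> u" shows "0 \<le> moment m u"
  unfolding moment_def
proof (intro integral_nonneg_AE AE_I2)
  show "0 \<le> x ^ m * u x" for x
    using bump_in_nonneg[OF u, of x] bump_in_zero[OF u, of x] by (cases "x \<in> {0<..<\<epsilon>}") auto
qed

lemma moment_antimono:
  assumes u: "bump_in 1 u" and "i \<le> j"
  shows "moment j u \<le> moment i u"
  using assms(2)
proof (induction rule: dec_induct)
  case (step n)
  with moment_Suc_le[OF u, of n] show ?case by simp
qed simp

lemma cheap_antimono:
  assumes "cheap p v k j" "i \<le> j" shows "cheap p v k i"
  unfolding cheap_def
proof (intro allI impI)
  fix \<epsilon> \<eta> :: real assume "0 < \<epsilon>" "0 < \<eta>"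
  then obtain u where u: "bump_in (min \<epsilon> 1) u" "1 \<le> moment j u" "cost p v ((deriv ^^ k) u) < ennreal \<eta>"
    using assms(1)[unfolded cheap_def, rule_format, of "min \<epsilon> 1" \<eta>] by auto
  have "1 \<le> moment i u"
    using moment_antimono[OF bump_in_mono[OF u(1)] \<open>i \<le> j\<close>] u(2) by simp
  with u show "\<exists>u. bump_in \<epsilon> u \<and> 1 \<le> moment i u \<and> cost p v ((deriv ^^ k) u) < ennreal \<eta>"
    by (intro exI[of _ u]) (auto intro: bump_in_mono)
qed

lemma cost_linear_combination:
  assumes [measurable]: "v \<in> borel_measurable borel" "a \<in> borel_measurable borel" "b \<in> borel_measurable borel"
    and v: "\<And>x. 0 \<le> v x" and p: "0 < p"
  shows "cost p v (\<lambda>x. s * a x + t * b x)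
    \<le> ennreal (2 powr p) * (ennreal (\<bar>s\<bar> powr p) * cost p v a + ennreal (\<bar>t\<bar> powr p) * cost p v b)"
proof -
  have pw: "\<bar>s * A + t * B\<bar> powr p \<le> 2 powr p * (\<bar>s\<bar> powr p * \<bar>A\<bar> powr p + \<bar>t\<bar> powr p * \<bar>B\<bar> powr p)" for A B
  proof -
    have "\<bar>s * A + t * B\<bar> powr p \<le> (2 * max \<bar>s * A\<bar> \<bar>t * B\<bar>) powr p"
      using p by (intro powr_mono2) auto
    also have "\<dots> = 2 powr p * max \<bar>s * A\<bar> \<bar>t * B\<bar> powr p"
      by (subst powr_mult) auto
    also have "max \<bar>s * A\<bar> \<bar>t * B\<bar> powr p \<le> \<bar>s * A\<bar> powr p + \<bar>t * B\<bar> powr p"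
      by (auto simp: max_def)
    finally show ?thesis by (simp add: abs_mult powr_mult)
  qed
  have "cost p v (\<lambda>x. s * a x + t * b x) \<le> (\<integral>\<^sup>+ x. ennreal (2 powr p) *
     (ennreal (\<bar>s\<bar> powr p) * ennreal (v x * \<bar>a x\<bar> powr p) + ennreal (\<bar>t\<bar> powr p) * ennreal (v x * \<bar>b x\<bar> powr p)) \<partial>lborel)"
    unfolding cost_def
  proof (rule nn_integral_mono)
    fix x
    have "v x * \<bar>s * a x + t * b x\<bar> powr p
       \<le> v x * (2 powr p * (\<bar>s\<bar> powr p * \<bar>a x\<bar> powr p + \<bar>t\<bar> powr p * \<bar>b x\<bar> powr p))"
      by (intro mult_left_mono pw v)
    also have "\<dots> = 2 powr p * (\<bar>s\<bar> powr p * (v x * \<bar>a x\<bar> powr p) + \<bar>t\<bar> powr p * (v x * \<bar>b x\<bar> powr p))"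
      by (simp add: algebra_simps)
    finally show "ennreal (v x * \<bar>s * a x + t * b x\<bar> powr p) \<le> ennreal (2 powr p) *
     (ennreal (\<bar>s\<bar> powr p) * ennreal (v x * \<bar>a x\<bar> powr p) + ennreal (\<bar>t\<bar> powr p) * ennreal (v x * \<bar>b x\<bar> powr p))"
      using v[of x] by (simp add: ennreal_leI flip: ennreal_mult ennreal_plus)
  qed
  also have "\<dots> = ennreal (2 powr p) * (ennreal (\<bar>s\<bar> powr p) * cost p v a + ennreal (\<bar>t\<bar> powr p) * cost p v b)"
    by (simp add: nn_integral_cmult nn_integral_add cost_def)
  finally show ?thesis .
qed

text \<open>
  The main step. The antiderivative \<open>\<phi>\<close> of \<open>f - \<psi>\<close>, with \<open>f\<close> to the left of \<open>\<psi>\<close> and of the same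
  integral, increases from \<open>0\<close> and then decreases to \<open>0\<close>. Integration by parts gives
  \<open>\<integral> x\<^sup>m \<phi> = (\<integral> x\<^bsup>m+1\<^esup> \<psi> - \<integral> x\<^bsup>m+1\<^esup> f) / (m + 1)\<close>, where the first integral is at least \<open>1\<close> and the second
  at most \<open>\<delta> \<integral> \<psi> \<le> 1/2\<close> if \<open>f\<close> is supported in \<open>(0, \<delta>)\<close>. The factor \<open>c = 2 (m + 1)\<close> restores the
  moment. The cost of \<open>D\<^sup>k f\<close> can be chosen after \<open>\<psi>\<close>, so it may be small relative to \<open>\<integral> \<psi>\<close>, over which
  there is no control.
\<close>

lemma cheap_Suc:
  assumes v: "v \<in> borel_measurable borel" "\<And>x. 0 \<le> v x" and p: "0 < p"
    and cheap_high: "cheap p v k (Suc m)" and cheap_0: "cheap p v k 0"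
  shows "cheap p v (Suc k) m"
  unfolding cheap_def
proof (intro allI impI)
  fix \<epsilon> \<eta> :: real assume \<epsilon>: "0 < \<epsilon>" and \<eta>: "0 < \<eta>"
  define c where "c = 2 * real (Suc m)"
  have c: "0 < c" by (simp add: c_def)
  \<comment> \<open>\<open>\<eta>1\<close> and \<open>\<eta>2\<close> are such that \<open>\<psi>\<close> and \<open>f\<close> each contribute at most \<open>\<eta> / 2\<close> to the final cost.\<close>
  define \<eta>1 where "\<eta>1 = \<eta> / (2 * (2 powr p * c powr p))"
  have \<eta>1: "0 < \<eta>1" using \<eta> c by (simp add: \<eta>1_def)
  obtain \<psi> where \<psi>: "bump_in \<epsilon> \<psi>" "1 \<le> moment (Suc m) \<psi>" "cost p v ((deriv ^^ k) \<psi>) < ennreal \<eta>1"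
    using cheap_high \<epsilon> \<eta>1 unfolding cheap_def by blast
  obtain \<alpha>1 \<beta>1 where \<psi>_supp: "0 < \<alpha>1" "\<alpha>1 \<le> \<beta>1" "\<beta>1 < \<epsilon>" "\<And>x. x \<notin> {\<alpha>1..\<beta>1} \<Longrightarrow> \<psi> x = 0"
    using \<psi>(1) unfolding bump_in_def by blast
  define T where "T = moment 0 \<psi>"
  have T: "0 \<le> T" unfolding T_def by (rule moment_nonneg[OF \<psi>(1)])
  define \<eta>2 where "\<eta>2 = \<eta> / (2 * (2 powr p * ((c * T) powr p + 1)))"
  \<comment> \<open>The summand \<open>1\<close> only guards against \<open>T = 0\<close>.\<close>
  have den: "0 < (c * T) powr p + 1" by (simp add: add_nonneg_pos)
  have \<eta>2: "0 < \<eta>2" using \<eta> den by (simp add: \<eta>2_def)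
  define \<delta> where "\<delta> = min \<alpha>1 (min 1 (1 / (2 * (T + 1))))"
  have \<delta>: "0 < \<delta>" "\<delta> \<le> \<alpha>1" "\<delta> \<le> 1" using \<psi>_supp(1) T unfolding \<delta>_def by (auto simp: min_le_iff_disj)
  have "\<delta> * T \<le> 1 / (2 * (T + 1)) * T"
    using T by (intro mult_right_mono) (auto simp: \<delta>_def)
  also have "\<dots> \<le> 1 / 2" using T by (simp add: field_simps)
  finally have \<delta>T: "\<delta> * T \<le> 1 / 2" .
  obtain f where f: "bump_in \<delta> f" "1 \<le> moment 0 f" "cost p v ((deriv ^^ k) f) < ennreal \<eta>2"
    using cheap_0 \<delta>(1) \<eta>2 unfolding cheap_def by blast
  obtain \<alpha>2 \<beta>2 where f_supp: "0 < \<alpha>2" "\<alpha>2 \<le> \<beta>2" "\<beta>2 < \<delta>" "\<And>x. x \<notin> {\<alpha>2..\<beta>2} \<Longrightarrow> f x = 0"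
    using f(1) unfolding bump_in_def by blast
  define \<tau> where "\<tau> = T / moment 0 f"
  have \<tau>: "0 \<le> \<tau>" "\<tau> \<le> T" using T f(2) by (auto simp: \<tau>_def divide_le_eq mult_le_cancel_left1)
  define \<theta> where "\<theta> x = \<tau> * f x - \<psi> x" for x
  have smooth_\<theta>: "smooth \<theta>" unfolding \<theta>_def
    by (intro smooth_diff smooth_cmult bump_in_smooth[OF f(1)] bump_in_smooth[OF \<psi>(1)])
  have cont_\<theta>: "isCont \<theta> x" for x
    using smooth_continuous_on[OF smooth_\<theta>, of UNIV] by (simp add: continuous_on_eq_continuous_at)
  have \<theta>_out: "\<theta> x = 0" if "x \<notin> {\<alpha>2..\<beta>1}" for x
    using that \<psi>_supp f_supp \<delta> by (auto simp: \<theta>_def)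
  have int_f: "integrable lborel (\<lambda>x. x ^ j * f x)" and int_\<psi>: "integrable lborel (\<lambda>x. x ^ j * \<psi> x)" for j
    by (rule integrable_moment[OF f(1)] integrable_moment[OF \<psi>(1)])+
  have moment_\<theta>: "moment j \<theta> = \<tau> * moment j f - moment j \<psi>" for j
  proof -
    have "moment j \<theta> = (LINT x|lborel. \<tau> * (x ^ j * f x) - x ^ j * \<psi> x)"
      unfolding moment_def \<theta>_def by (simp add: algebra_simps)
    also have "\<dots> = \<tau> * moment j f - moment j \<psi>"
      using int_f[of j] int_\<psi>[of j] by (simp add: moment_def)
    finally show ?thesis .
  qed
  \<comment> \<open>\<open>F - F 0\<close> is the desired profile: it vanishes on both sides of the supports.\<close>
  obtain F where F: "\<And>x. (F has_real_derivative \<theta> x) (at x)"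
    using einterval_antiderivative[of "-\<infinity>" "\<infinity>" \<theta>] cont_\<theta>
    by (auto simp: has_real_derivative_iff_has_vector_derivative)
  have F_le: "F x \<le> F y" if "x \<le> y" "\<And>z. x \<le> z \<Longrightarrow> z \<le> y \<Longrightarrow> 0 \<le> \<theta> z" for x y
    using DERIV_nonneg_imp_nondecreasing[OF that(1), of F] F that(2) by blast
  have F_ge: "F y \<le> F x" if "x \<le> y" "\<And>z. x \<le> z \<Longrightarrow> z \<le> y \<Longrightarrow> \<theta> z \<le> 0" for x y
    using DERIV_nonpos_imp_nonincreasing[OF that(1), of F] F that(2) by blast
  have F_eq: "F x = F y" if "x \<le> y" "\<And>z. x \<le> z \<Longrightarrow> z \<le> y \<Longrightarrow> \<theta> z = 0" for x y
    using F_le[of x y] F_ge[of x y] that by force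
  have F_left: "F x = F 0" if "x < \<alpha>2" for x
    using F_eq[of x 0] F_eq[of 0 x] that f_supp(1) \<theta>_out by (cases "x \<le> 0") force+
  have "F \<epsilon> - F 0 = (LINT x|lborel. \<theta> x)"
    using \<epsilon> \<theta>_out f_supp \<psi>_supp by (intro integral_eq_antiderivative_diff[symmetric] F cont_\<theta>) auto
  also have "\<dots> = moment 0 \<theta>" by (simp add: moment_def)
  also have "\<dots> = 0" using f(2) by (simp add: moment_\<theta> \<tau>_def T_def)
  finally have F_\<epsilon>: "F \<epsilon> = F 0" by simp
  have F_right: "F x = F 0" if "\<beta>1 < x" for x
    using F_eq[of x \<epsilon>] F_eq[of \<epsilon> x] that \<psi>_supp(3) \<theta>_out F_\<epsilon> by (cases "x \<le> \<epsilon>") force+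
  \<comment> \<open>\<open>F\<close> increases up to \<open>\<alpha>1\<close>, where \<open>\<psi>\<close> is zero, and decreases from there on, where \<open>f\<close> is zero.\<close>
  have F_nonneg: "F 0 \<le> F x" for x
  proof (cases "x < \<alpha>1")
    case True
    have "F (min x 0) \<le> F x"
    proof (rule F_le)
      show "0 \<le> \<theta> z" if "z \<le> x" for z
        using that True \<psi>_supp(4)[of z] \<tau>(1) bump_in_nonneg[OF f(1), of z] by (simp add: \<theta>_def)
    qed auto
    then show ?thesis using F_left[of "min x 0"] f_supp(1) by simp
  next
    case False
    have "F (max x \<epsilon>) \<le> F x"
    proof (rule F_ge)
      show "\<theta> z \<le> 0" if "x \<le> z" for z
        using that False f_supp(3) f_supp(4)[of z] \<delta>(2) bump_in_nonneg[OF \<psi>(1), of z] by (simp add: \<theta>_def)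
    qed auto
    then show ?thesis using F_right[of "max x \<epsilon>"] \<psi>_supp(3) by simp
  qed
  define \<phi> where "\<phi> x = c * (F x - F 0)" for x
  have \<phi>_deriv: "(\<phi> has_real_derivative c * \<theta> x) (at x)" for x
    unfolding \<phi>_def by (auto intro!: derivative_eq_intros F)
  have smooth_\<phi>: "smooth \<phi>"
    by (rule smooth_antiderivative[OF \<phi>_deriv]) (intro smooth_cmult smooth_\<theta>)
  have bump_\<phi>: "bump_in \<epsilon> \<phi>"
    unfolding bump_in_def
  proof (intro conjI exI allI impI)
    show "0 \<le> \<phi> x" for x using c F_nonneg[of x] by (simp add: \<phi>_def)
    show "\<phi> x = 0" if "x \<notin> {\<alpha>2..\<beta>1}" for x
      using that F_left[of x] F_right[of x] by (auto simp: \<phi>_def not_le)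
  qed (use smooth_\<phi> f_supp \<psi>_supp \<delta> in auto)
  \<comment> \<open>Integration by parts: the integrand is the derivative of \<open>x ^ Suc m * \<phi> x\<close>.\<close>
  have "(LINT x|lborel. real (Suc m) * (x ^ m * \<phi> x) + c * (x ^ Suc m * \<theta> x)) = \<epsilon> ^ Suc m * \<phi> \<epsilon> - 0 ^ Suc m * \<phi> 0"
  proof (rule integral_eq_antiderivative_diff[where F = "\<lambda>x. x ^ Suc m * \<phi> x" and a = 0 and b = \<epsilon>])
    show "((\<lambda>x. x ^ Suc m * \<phi> x) has_real_derivative real (Suc m) * (x ^ m * \<phi> x) + c * (x ^ Suc m * \<theta> x)) (at x)" for x
      by (rule derivative_eq_intros \<phi>_deriv refl)+ (simp add: algebra_simps)
    show "isCont (\<lambda>x. real (Suc m) * (x ^ m * \<phi> x) + c * (x ^ Suc m * \<theta> x)) x" for x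
      by (intro continuous_intros cont_\<theta> DERIV_isCont[OF \<phi>_deriv])
    show "real (Suc m) * (x ^ m * \<phi> x) + c * (x ^ Suc m * \<theta> x) = 0" if "x \<notin> {0..\<epsilon>}" for x
      using that bump_in_zero[OF bump_\<phi>, of x] \<theta>_out[of x] f_supp(1) \<psi>_supp(3) by auto
  qed (use \<epsilon> in simp)
  moreover have "\<phi> \<epsilon> = 0" by (simp add: \<phi>_def F_\<epsilon>)
  moreover have "integrable lborel (\<lambda>x. x ^ Suc m * \<theta> x)"
  proof -
    have "integrable lborel (\<lambda>x. \<tau> * (x ^ Suc m * f x) - x ^ Suc m * \<psi> x)"
      using int_f[of "Suc m"] int_\<psi>[of "Suc m"] by auto
    then show ?thesis by (simp add: \<theta>_def algebra_simps)
  qed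
  ultimately have "real (Suc m) * moment m \<phi> + c * moment (Suc m) \<theta> = 0"
    using integrable_moment[OF bump_\<phi>, of m] unfolding moment_def by simp
  then have "real (Suc m) * (moment m \<phi> + 2 * moment (Suc m) \<theta>) = 0"
    by (simp add: c_def algebra_simps)
  then have "moment m \<phi> = - 2 * moment (Suc m) \<theta>" by simp
  moreover have "moment (Suc m) \<theta> \<le> - (1 / 2)"
  proof -
    have "moment (Suc m) f \<le> \<delta> * moment m f" by (rule moment_Suc_le[OF f(1) \<delta>(3)])
    also have "\<dots> \<le> \<delta> * moment 0 f"
      using \<delta> moment_antimono[OF bump_in_mono[OF f(1) \<delta>(3)], of 0 m] by simp
    finally have "\<tau> * moment (Suc m) f \<le> \<tau> * (\<delta> * moment 0 f)"
      using \<tau>(1) by (rule mult_left_mono)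
    also have "\<dots> = \<delta> * T" using f(2) by (simp add: \<tau>_def)
    finally show ?thesis using \<delta>T \<psi>(2) unfolding moment_\<theta> by linarith
  qed
  ultimately have mom: "1 \<le> moment m \<phi>" by simp
  have deriv_eq: "(deriv ^^ Suc k) \<phi> = (\<lambda>x. (c * \<tau>) * (deriv ^^ k) f x + (- c) * (deriv ^^ k) \<psi> x)"
  proof -
    have "deriv \<phi> = (\<lambda>x. (c * \<tau>) * f x + (- c) * \<psi> x)"
      using has_derivative_imp_deriv_eq[OF \<phi>_deriv] by (simp add: \<theta>_def algebra_simps)
    then show ?thesis
      unfolding deriv_funpow_Suc
      using bump_in_smooth[OF f(1)] bump_in_smooth[OF \<psi>(1)]
      by (simp only: funpow_deriv_add funpow_deriv_cmult smooth_cmult)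
  qed
  obtain Cf where Cf: "cost p v ((deriv ^^ k) f) = ennreal Cf" "0 \<le> Cf" "Cf < \<eta>2"
    using f(3) by (cases "cost p v ((deriv ^^ k) f)") (auto simp: ennreal_less_iff)
  obtain C\<psi> where C\<psi>: "cost p v ((deriv ^^ k) \<psi>) = ennreal C\<psi>" "0 \<le> C\<psi>" "C\<psi> < \<eta>1"
    using \<psi>(3) by (cases "cost p v ((deriv ^^ k) \<psi>)") (auto simp: ennreal_less_iff)
  have "cost p v ((deriv ^^ Suc k) \<phi>) \<le> ennreal (2 powr p) *
      (ennreal (\<bar>c * \<tau>\<bar> powr p) * cost p v ((deriv ^^ k) f) + ennreal (\<bar>- c\<bar> powr p) * cost p v ((deriv ^^ k) \<psi>))"
    unfolding deriv_eq
    by (intro cost_linear_combination v p smooth_borel smooth_funpow_deriv bump_in_smooth[OF f(1)] bump_in_smooth[OF \<psi>(1)])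
  also have "\<dots> = ennreal (2 powr p * ((c * \<tau>) powr p * Cf + c powr p * C\<psi>))"
    using c \<tau>(1) Cf(2) C\<psi>(2) by (simp add: Cf(1) C\<psi>(1) flip: ennreal_mult ennreal_plus)
  also have "\<dots> < ennreal \<eta>"
  proof (rule ennreal_lessI[OF \<eta>])
    have "2 powr p * ((c * \<tau>) powr p * Cf) \<le> 2 powr p * (((c * T) powr p + 1) * \<eta>2)"
    proof (intro mult_left_mono mult_mono)
      have "(c * \<tau>) powr p \<le> (c * T) powr p" using c \<tau> p by (intro powr_mono2) auto
      then show "(c * \<tau>) powr p \<le> (c * T) powr p + 1" by simp
    qed (use Cf den in auto)
    also have "\<dots> = \<eta> / 2" using den by (simp add: \<eta>2_def)
    finally have 1: "2 powr p * ((c * \<tau>) powr p * Cf) \<le> \<eta> / 2" .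
    have "2 powr p * (c powr p * C\<psi>) < 2 powr p * (c powr p * \<eta>1)"
      using c C\<psi>(3) by (intro mult_strict_left_mono) auto
    also have "\<dots> = \<eta> / 2" using c by (simp add: \<eta>1_def)
    finally show "2 powr p * ((c * \<tau>) powr p * Cf + c powr p * C\<psi>) < \<eta>"
      using 1 by (simp add: distrib_left)
  qed
  finally have "cost p v ((deriv ^^ Suc k) \<phi>) < ennreal \<eta>" .
  with bump_\<phi> mom show "\<exists>u. bump_in \<epsilon> u \<and> 1 \<le> moment m u \<and> cost p v ((deriv ^^ Suc k) u) < ennreal \<eta>"
    by blast
qed

text \<open>
  Each step trades one order of the moment for one derivative, so criticality of order \<open>k\<close>
  pays for \<open>k\<close> derivatives.
\<close>

lemma cheap_of_critical:
  assumes v: "v \<in> borel_measurable borel" "\<And>x. 0 \<le> v x" "\<And>x. v x \<le> M" and p: "1 \<le> p"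
    and crit: "critical_at_0 p k v"
  shows "i \<le> k \<Longrightarrow> cheap p v i (k - i)"
proof (induction i)
  case 0
  show ?case using cheap_0_of_critical[OF v p crit] by simp
next
  case (Suc i)
  then have "cheap p v i (Suc (k - Suc i))" by (simp add: Suc_diff_Suc)
  moreover from this have "cheap p v i 0" by (rule cheap_antimono) simp
  ultimately show ?case using v(1,2) p by (intro cheap_Suc) auto
qed

section \<open>Transport to an arbitrary point and side\<close>

lemma epowr_measurable [measurable (raw)]:
  assumes [measurable]: "f \<in> borel_measurable M"
  shows "(\<lambda>x. epowr (f x) r) \<in> borel_measurable M"
  unfolding epowr_def by measurable

lemma epowr_le:
  assumes "x \<le> ennreal y" "0 \<le> y" "0 \<le> r"
  shows "epowr x r \<le> ennreal (y powr r)"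
proof -
  have "x \<noteq> \<infinity>" using assms(1) by (auto simp: top_unique)
  moreover have "enn2real x \<le> y" using assms by (simp add: enn2real_leI)
  ultimately show ?thesis
    using assms(3) by (auto simp: epowr_def intro!: ennreal_leI powr_mono2)
qed

text \<open>
  This excludes an endpoint of \<open>I\<close> with half-balls that point out of \<open>I\<close>.
\<close>

lemma not_critical_if_empty:
  assumes "closure I \<inter> B x0 1 = {}" shows "x0 \<notin> critical_set B \<alpha> p I w"
proof (cases "p = 1")
  case True
  have "esssup (lebesgue_on {}) (\<lambda>x. ennreal (\<bar>x - x0\<bar> powr \<alpha>) / ennreal (w x)) \<le> 0"
    by (intro esssup_I AE_I2) (auto simp: measurable_def space_restrict_space)
  then show ?thesis using True assms
    by (auto simp: critical_set_def intro!: exI[of _ 1])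
next
  case False
  have "(\<integral>\<^sup>+ x. F x \<partial>lebesgue_on {}) = 0" for F :: "real \<Rightarrow> ennreal"
    by (simp add: nn_integral_restrict_space)
  then show ?thesis using False assms
    by (auto simp: critical_set_def intro!: exI[of _ 1])
qed

text \<open>
  Clipping a Borel version of \<open>w\<close> at \<open>0\<close> and at its essential bound changes it only on a null set of
  \<open>S\<close>; the result is defined, bounded and non-negative on all of \<open>\<real>\<close>, whatever \<open>w\<close> does
  outside \<open>S\<close>.
\<close>

lemma borel_representative:
  fixes w :: "real \<Rightarrow> real"
  assumes I: "I \<in> sets borel" and w: "weight I w"
    and S: "S \<in> sets borel" "S \<subseteq> I" "w \<in> L_infinity S"
  obtains wb M where "wb \<in> borel_measurable borel" "\<And>x. 0 \<le> wb x" "\<And>x. wb x \<le> M"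
    "AE x in lborel. x \<in> S \<longrightarrow> w x = wb x"
proof -
  have "w \<in> borel_measurable (lebesgue_on I)"
    using w by (auto simp: weight_def)
  then have "(\<lambda>x. indicator I x *\<^sub>R w x) \<in> borel_measurable lebesgue"
    using I by (subst (asm) borel_measurable_restrict_space_iff) auto
  from completion_ex_borel_measurable_real[of "\<lambda>x. indicator I x *\<^sub>R w x" lborel, OF this]
  obtain g where g: "g \<in> borel_measurable lborel" and eq: "AE x in lborel. indicator I x *\<^sub>R w x = g x"
    by auto
  have nonneg: "AE x in lborel. x \<in> I \<longrightarrow> 0 \<le> w x"
    using w I by (auto simp: weight_def AE_restrict_space_iff AE_completion_iff)
  have fin: "esssup (lebesgue_on S) (\<lambda>x. ennreal \<bar>w x\<bar>) < \<infinity>"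
    using S(3) by (simp add: L_infinity_def)
  define M where "M = enn2real (esssup (lebesgue_on S) (\<lambda>x. ennreal \<bar>w x\<bar>))"
  have "AE x in lebesgue_on S. ennreal \<bar>w x\<bar> \<le> ennreal M"
    using esssup_AE[of "\<lambda>x. ennreal \<bar>w x\<bar>" "lebesgue_on S"] fin by (simp add: M_def)
  then have bound: "AE x in lborel. x \<in> S \<longrightarrow> \<bar>w x\<bar> \<le> M"
    using S(1) by (simp add: AE_restrict_space_iff AE_completion_iff M_def)
  show thesis
  proof
    show "(\<lambda>x. max 0 (min M (g x))) \<in> borel_measurable borel" using g by simp
    show "max 0 (min M (g x)) \<le> M" for x by (simp add: M_def)
    show "AE x in lborel. x \<in> S \<longrightarrow> w x = max 0 (min M (g x))"
      using eq nonneg bound by eventually_elim (use S(2) in auto)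
  qed simp
qed

text \<open>
  The sign \<open>s\<close> selects the side on which the half-balls at \<open>x0\<close> lie; \<open>t \<mapsto> x0 + s * t\<close> maps
  \<open>(0, \<epsilon>)\<close> onto the half-ball of radius \<open>\<epsilon>\<close>.
\<close>

locale half_ball_side =
  fixes s :: real and B :: "real \<Rightarrow> real \<Rightarrow> real set" and x0 :: real
  assumes s: "s = 1 \<or> s = - 1"
    and B: "x \<in> B x0 \<epsilon> \<longleftrightarrow> s * (x - x0) \<in> {0<..<\<epsilon>}"
begin

lemma in_B_iff: "x0 + s * t \<in> B x0 \<epsilon> \<longleftrightarrow> t \<in> {0<..<\<epsilon>}"
  using s by (auto simp: B)

lemma B_borel [measurable]: "B x0 \<epsilon> \<in> sets borel"
proof -
  have "B x0 \<epsilon> = {x \<in> space borel. s * (x - x0) \<in> {0<..<\<epsilon>}}" using B by auto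
  also have "\<dots> \<in> sets borel" by measurable
  finally show ?thesis .
qed

lemma nn_integral_substitute:
  "f \<in> borel_measurable borel \<Longrightarrow> (\<integral>\<^sup>+ x. f x \<partial>lborel) = (\<integral>\<^sup>+ t. f (x0 + s * t) \<partial>lborel)"
  using nn_integral_real_affine[of f s x0] s by auto

text \<open>
  Criticality concerns only arbitrarily small half-balls, so it can be tested inside \<open>B x0 c\<close>, where
  \<open>w\<close> may be replaced by its Borel version.
\<close>

lemma critical_at_0_transport:
  assumes c: "0 < c" "B x0 c \<subseteq> I"
    and w: "w \<in> borel_measurable (lebesgue_on I)" and I: "I \<in> sets borel"
    and [measurable]: "wb \<in> borel_measurable borel" and eq: "AE x in lborel. x \<in> B x0 c \<longrightarrow> w x = wb x"
    and crit: "x0 \<in> critical_set B (real k) p I w"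
  shows "critical_at_0 p k (\<lambda>t. wb (x0 + s * t))"
  unfolding critical_at_0_def
proof (intro allI impI)
  fix \<epsilon> :: real assume \<epsilon>: "0 < \<epsilon>"
  define e where "e = min \<epsilon> c"
  have e: "0 < e" "e \<le> \<epsilon>" "e \<le> c" using \<epsilon> c by (auto simp: e_def)
  have sub: "B x0 e \<subseteq> B x0 c" using e by (auto simp: B)
  then have closure: "closure I \<inter> B x0 e = B x0 e" using c(2) closure_subset[of I] by auto
  have eq_e: "AE x in lebesgue. x \<in> B x0 e \<longrightarrow> w x = wb x"
    using eq sub unfolding AE_completion_iff by (auto elim!: eventually_mono)
  have dist: "\<bar>x0 + s * t - x0\<bar> powr real k = t ^ k" if "0 < t" for t
    using s that by (auto simp: powr_realpow)
  show "if p = 1 then \<forall>K>0. 0 < emeasure lborel {t \<in> {0<..<\<epsilon>}. K * wb (x0 + s * t) < t ^ k}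
     else (\<integral>\<^sup>+ t\<in>{0<..<\<epsilon>}.
       epowr (ennreal (t ^ k) / epowr (ennreal (wb (x0 + s * t))) (1 / p)) (holder_conjugate p) \<partial>lborel) = \<infinity>"
  proof (cases "p = 1")
    case True
    let ?f = "\<lambda>x. ennreal (\<bar>x - x0\<bar> powr real k) / ennreal (w x)"
    have inf: "esssup (lebesgue_on (B x0 e)) ?f = \<infinity>"
      using crit True e(1) closure by (auto simp: critical_set_def)
    have [measurable]: "w \<in> borel_measurable (lebesgue_on (B x0 e))"
      by (rule measurable_restrict_mono[OF w]) (use sub c(2) in auto)
    have [measurable]: "(\<lambda>x. \<bar>x - x0\<bar> powr real k) \<in> borel_measurable (lebesgue_on (B x0 e))"
      by (intro measurable_restrict_space1 measurable_completion) measurable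
    have f: "?f \<in> borel_measurable (lebesgue_on (B x0 e))"
      by measurable
    have "0 < emeasure lborel {t \<in> {0<..<\<epsilon>}. K * wb (x0 + s * t) < t ^ k}" if K: "0 < K" for K
    proof (rule ccontr)
      let ?T = "{x \<in> B x0 e. K * wb x < (s * (x - x0)) ^ k}"
      assume "\<not> 0 < emeasure lborel {t \<in> {0<..<\<epsilon>}. K * wb (x0 + s * t) < t ^ k}"
      then have null: "emeasure lborel {t \<in> {0<..<\<epsilon>}. K * wb (x0 + s * t) < t ^ k} = 0" by simp
      have [measurable]: "?T \<in> sets borel" by measurable
      have "emeasure lborel ?T = (\<integral>\<^sup>+ x. indicator ?T x \<partial>lborel)" by simp
      also have "\<dots> = (\<integral>\<^sup>+ t. indicator ?T (x0 + s * t) \<partial>lborel)"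
        by (rule nn_integral_substitute) measurable
      also have "\<dots> \<le> (\<integral>\<^sup>+ t. indicator {t \<in> {0<..<\<epsilon>}. K * wb (x0 + s * t) < t ^ k} t \<partial>lborel)"
        using s e(2) by (intro nn_integral_mono) (auto simp: indicator_def in_B_iff)
      also have "\<dots> = 0"
        using null by (subst nn_integral_indicator) simp_all
      finally have "emeasure lborel ?T = 0" by simp
      then have "AE x in lborel. x \<notin> ?T"
        by (intro AE_not_in null_setsI) auto
      then have "AE x in lebesgue. x \<notin> ?T" by (simp only: AE_completion_iff)
      then have "AE x in lebesgue. x \<in> B x0 e \<longrightarrow> ?f x \<le> ennreal K"
        using eq_e
      proof eventually_elim
        case (elim x)
        show ?case
        proof
          assume x: "x \<in> B x0 e"
          then have pos: "0 < s * (x - x0)" by (simp add: B)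
          have "\<bar>x - x0\<bar> = s * (x - x0)" using s pos by auto
          with pos have d: "\<bar>x - x0\<bar> powr real k = (s * (x - x0)) ^ k"
            by (simp add: powr_realpow)
          have le: "(s * (x - x0)) ^ k \<le> K * w x" using elim x by auto
          moreover have "0 < (s * (x - x0)) ^ k" using pos by simp
          ultimately have "0 < K * w x" by linarith
          then have wx: "0 < w x" using K by (simp add: zero_less_mult_iff)
          then show "?f x \<le> ennreal K"
            using le pos K unfolding d by (simp add: divide_ennreal ennreal_leI divide_le_eq)
        qed
      qed
      then have "AE x in lebesgue_on (B x0 e). ?f x \<le> ennreal K"
        by (subst AE_restrict_space_iff) auto
      from esssup_I[OF f this] inf show False by (simp add: top_unique)
    qed
    with True show ?thesis by simp
  next
    case False
    let ?F = "\<lambda>y z. epowr (ennreal y / epowr (ennreal z) (1 / p)) (holder_conjugate p)"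
    have "\<infinity> = (\<integral>\<^sup>+ x. ?F (\<bar>x - x0\<bar> powr real k) (w x) \<partial>lebesgue_on (B x0 e))"
      using crit False e(1) closure by (auto simp: critical_set_def)
    also have "\<dots> = (\<integral>\<^sup>+ x. ?F (\<bar>x - x0\<bar> powr real k) (w x) * indicator (B x0 e) x \<partial>lebesgue)"
      by (rule nn_integral_restrict_space) simp
    also have "\<dots> = (\<integral>\<^sup>+ x. ?F (\<bar>x - x0\<bar> powr real k) (wb x) * indicator (B x0 e) x \<partial>lebesgue)"
      by (intro nn_integral_cong_AE eventually_mono[OF eq_e]) (auto simp: indicator_def)
    also have "\<dots> = (\<integral>\<^sup>+ x. ?F (\<bar>x - x0\<bar> powr real k) (wb x) * indicator (B x0 e) x \<partial>lborel)"
      by (rule nn_integral_completion)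
    also have "\<dots> = (\<integral>\<^sup>+ t. ?F (\<bar>x0 + s * t - x0\<bar> powr real k) (wb (x0 + s * t)) * indicator (B x0 e) (x0 + s * t) \<partial>lborel)"
      by (rule nn_integral_substitute) measurable
    also have "\<dots> \<le> (\<integral>\<^sup>+ t. ?F (t ^ k) (wb (x0 + s * t)) * indicator {0<..<\<epsilon>} t \<partial>lborel)"
    proof (rule nn_integral_mono)
      fix t
      show "?F (\<bar>x0 + s * t - x0\<bar> powr real k) (wb (x0 + s * t)) * indicator (B x0 e) (x0 + s * t)
        \<le> ?F (t ^ k) (wb (x0 + s * t)) * indicator {0<..<\<epsilon>} t"
      proof (cases "t \<in> {0<..<e}")
        case True
        then show ?thesis using dist[of t] e(2) by (simp add: in_B_iff)
      qed (simp add: in_B_iff)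
    qed
    finally show ?thesis using False by (simp add: top_unique)
  qed
qed

text \<open>
  Dividing by the integral, which is at least \<open>1\<close>, does not increase the cost, and the reflection
  changes derivatives only by a sign.
\<close>

lemma normalised_bump_transport:
  assumes c: "B x0 c \<subseteq> I" and I: "I \<in> sets borel"
    and [measurable]: "wb \<in> borel_measurable borel" and wb: "\<And>x. 0 \<le> wb x"
    and eq: "AE x in lborel. x \<in> B x0 c \<longrightarrow> w x = wb x"
    and p: "1 \<le> p"
    and u: "bump_in (min c \<epsilon>) u" "1 \<le> moment 0 u"
  obtains \<phi> where "\<phi> \<in> test_functions (B x0 \<epsilon>)" "\<And>x. 0 \<le> \<phi> x" "(LINT x|lebesgue_on I. \<phi> x) = 1"
    "weighted_Lp_norm p I w ((deriv ^^ k) \<phi>) \<le> epowr (cost p (\<lambda>t. wb (x0 + s * t)) ((deriv ^^ k) u)) (1 / p)"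
proof -
  define m where "m = 1 / moment 0 u"
  have m: "0 < m" "m \<le> 1" using u(2) by (auto simp: m_def)
  define \<phi> where "\<phi> x = m * u (s * x + (- s * x0))" for x
  have s2: "s * (x0 + s * t) + (- s * x0) = t" for t using s by (auto simp: algebra_simps)
  note su = bump_in_smooth[OF u(1)]
  obtain \<alpha> \<beta> where ab: "0 < \<alpha>" "\<alpha> \<le> \<beta>" "\<beta> < min c \<epsilon>" "\<And>t. t \<notin> {\<alpha>..\<beta>} \<Longrightarrow> u t = 0"
    using u(1) unfolding bump_in_def by blast
  define S where "S = {x. s * (x - x0) \<in> {\<alpha>..\<beta>}}"
  have S_eq: "S = (if s = 1 then {x0 + \<alpha>..x0 + \<beta>} else {x0 - \<beta>..x0 - \<alpha>})"
    using s by (auto simp: S_def)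
  have S: "compact S" "closed S" unfolding S_eq by auto
  have SB: "S \<subseteq> B x0 c" "S \<subseteq> B x0 \<epsilon>" using ab by (auto simp: S_def B)
  have \<phi>_out: "\<phi> x = 0" if "x \<notin> S" for x
    using that ab(4)[of "s * x + (- s * x0)"] by (auto simp: S_def \<phi>_def algebra_simps)
  have smooth_\<phi>: "smooth \<phi>" unfolding \<phi>_def by (intro smooth_cmult smooth_affine su)
  then have [measurable]: "\<phi> \<in> borel_measurable borel" by (rule smooth_borel)
  have supp: "closure {x. \<phi> x \<noteq> 0} \<subseteq> S"
    using \<phi>_out S(2) by (intro closure_minimal) auto
  have test: "\<phi> \<in> test_functions (B x0 \<epsilon>)"
    unfolding test_functions_def
  proof (intro CollectI conjI)
    show "\<forall>k x. (deriv ^^ k) \<phi> differentiable at x" using smooth_\<phi> by (simp add: smooth_def)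
    show "compact (closure {x. \<phi> x \<noteq> 0})"
      using compact_Int_closed[OF S(1) closed_closure[of "{x. \<phi> x \<noteq> 0}"]] supp
      by (simp add: Int_absorb1)
  qed (use supp SB in auto)
  have nonneg: "0 \<le> \<phi> x" for x using m bump_in_nonneg[OF u(1)] by (simp add: \<phi>_def)
  have "(LINT x|lebesgue_on I. \<phi> x) = (LINT x|lebesgue. indicator I x *\<^sub>R \<phi> x)"
    using I by (intro integral_restrict_space) auto
  also have "\<dots> = (LINT x|lebesgue. \<phi> x)"
    using \<phi>_out SB c by (intro Bochner_Integration.integral_cong) (auto simp: indicator_def)
  also have "\<dots> = (LINT x|lborel. \<phi> x)" by (rule integral_completion) simp
  also have "\<dots> = (LINT t|lborel. \<phi> (x0 + s * t))"
    using lborel_integral_real_affine[of s \<phi> x0] s by auto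
  also have "\<dots> = m * moment 0 u" by (simp add: \<phi>_def s2[simplified] moment_def)
  also have "\<dots> = 1" using u(2) by (simp add: m_def)
  finally have int: "(LINT x|lebesgue_on I. \<phi> x) = 1" .
  let ?D = "(deriv ^^ k) \<phi>"
  have [measurable]: "?D \<in> borel_measurable borel"
    by (intro smooth_borel smooth_funpow_deriv smooth_\<phi>)
  have D_out: "?D x = 0" if "x \<notin> S" for x
    using funpow_deriv_zero_outside[of S \<phi> x k] S(2) \<phi>_out that by blast
  have D: "\<bar>?D (x0 + s * t)\<bar> \<le> \<bar>(deriv ^^ k) u t\<bar>" for t
  proof -
    have "?D = (\<lambda>x. m * (s ^ k * (deriv ^^ k) u (s * x + (- s * x0))))"
      unfolding \<phi>_def by (simp only: funpow_deriv_cmult[OF smooth_affine[OF su]] funpow_deriv_affine[OF su])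
    then have "?D (x0 + s * t) = m * (s ^ k * (deriv ^^ k) u t)" by (simp only: s2)
    moreover have "\<bar>s ^ k\<bar> = 1" using s by (auto simp: power_abs)
    ultimately have "\<bar>?D (x0 + s * t)\<bar> = m * \<bar>(deriv ^^ k) u t\<bar>" using m by (simp add: abs_mult)
    also have "\<dots> \<le> 1 * \<bar>(deriv ^^ k) u t\<bar>" using m by (intro mult_right_mono) auto
    finally show ?thesis by simp
  qed
  have eq': "AE x in lebesgue. x \<in> B x0 c \<longrightarrow> w x = wb x" using eq by (simp only: AE_completion_iff)
  have "(\<integral>\<^sup>+ x. ennreal (w x) * ennreal (\<bar>?D x\<bar> powr p) \<partial>lebesgue_on I)
      = (\<integral>\<^sup>+ x. ennreal (w x) * ennreal (\<bar>?D x\<bar> powr p) * indicator I x \<partial>lebesgue)"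
    using I by (intro nn_integral_restrict_space) auto
  also have "\<dots> = (\<integral>\<^sup>+ x. ennreal (wb x * \<bar>?D x\<bar> powr p) \<partial>lebesgue)"
    using eq'
  proof (intro nn_integral_cong_AE, eventually_elim)
    case (elim x)
    then show ?case
      using SB c D_out[of x] wb[of x] p by (cases "x \<in> S") (auto simp: ennreal_mult)
  qed
  also have "\<dots> = (\<integral>\<^sup>+ x. ennreal (wb x * \<bar>?D x\<bar> powr p) \<partial>lborel)"
    by (rule nn_integral_completion)
  also have "\<dots> = (\<integral>\<^sup>+ t. ennreal (wb (x0 + s * t) * \<bar>?D (x0 + s * t)\<bar> powr p) \<partial>lborel)"
    by (rule nn_integral_substitute) measurable
  also have "\<dots> \<le> cost p (\<lambda>t. wb (x0 + s * t)) ((deriv ^^ k) u)"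
    unfolding cost_def using D wb p
    by (intro nn_integral_mono ennreal_leI mult_left_mono powr_mono2) auto
  finally have le: "(\<integral>\<^sup>+ x. ennreal (w x) * ennreal (\<bar>?D x\<bar> powr p) \<partial>lebesgue_on I)
     \<le> cost p (\<lambda>t. wb (x0 + s * t)) ((deriv ^^ k) u)" (is "?L \<le> ?R") .
  have "weighted_Lp_norm p I w ?D \<le> epowr ?R (1 / p)"
  proof (cases "?R = \<infinity>")
    case True
    then show ?thesis by (simp add: epowr_def)
  next
    case False
    then have "epowr ?R (1 / p) = ennreal (enn2real ?R powr (1 / p))" by (simp add: epowr_def)
    then show ?thesis
      unfolding weighted_Lp_norm_def using le False p by (simp add: epowr_le top.not_eq_extremum)
  qed
  with test nonneg int show thesis by (rule that)
qed

theorem vanishing_test_functions: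
  assumes I: "I = {a<..<b}" "a < b" and p: "1 \<le> p" and w: "weight I w" and x0: "x0 \<in> closure I"
    and r: "0 < r" "w \<in> L_infinity (B x0 r \<inter> I)"
    and crit: "x0 \<in> critical_set B (real k) p I w"
  shows "\<exists>\<phi> :: nat \<Rightarrow> real \<Rightarrow> real.
    (\<forall>h\<ge>1. \<phi> h \<in> test_functions (B x0 (1 / real h)) \<and> (\<forall>x. 0 \<le> \<phi> h x) \<and>
           (LINT x|lebesgue_on I. \<phi> h x) = 1) \<and>
    (\<lambda>h. weighted_Lp_norm p I w ((deriv ^^ k) (\<phi> h))) \<longlonglongrightarrow> 0"
proof -
  have cl: "closure I = {a..b}" using I by simp
  \<comment> \<open>Small half-balls lie inside \<open>I\<close>, as otherwise they would point out of \<open>I\<close> at an endpoint.\<close>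
  have "\<exists>c>0. B x0 c \<subseteq> I"
  proof (rule ccontr)
    assume no: "\<not> (\<exists>c>0. B x0 c \<subseteq> I)"
    have "closure I \<inter> B x0 1 = {}"
    proof (cases "s = 1")
      case True
      have "\<not> x0 < b"
        using no[simplified, rule_format, of "b - x0"] x0 unfolding cl unfolding I(1) by (auto simp: B True)
      then have "x \<notin> B x0 1" if "x \<in> closure I" for x
        using that B[of x 1] True cl by auto
      then show ?thesis by blast
    next
      case False
      with s have s': "s = - 1" by simp
      have "\<not> a < x0"
        using no[simplified, rule_format, of "x0 - a"] x0 unfolding cl unfolding I(1) by (auto simp: B s')
      then have "x \<notin> B x0 1" if "x \<in> closure I" for x
        using that B[of x 1] s' cl by auto
      then show ?thesis by blast
    qed
    with not_critical_if_empty crit show False by blast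
  qed
  then obtain c0 where c0: "0 < c0" "B x0 c0 \<subseteq> I" by blast
  define c where "c = min c0 r"
  have c: "0 < c" using c0 r by (simp add: c_def)
  have cI: "B x0 c \<subseteq> I" and cr: "B x0 c \<subseteq> B x0 r \<inter> I"
    using c0(2) by (auto simp: c_def B)
  have Ib: "I \<in> sets borel" using I by simp
  obtain wb M where wb: "wb \<in> borel_measurable borel" "\<And>x. 0 \<le> wb x" "\<And>x. wb x \<le> M"
    and "AE x in lborel. x \<in> B x0 r \<inter> I \<longrightarrow> w x = wb x"
    using borel_representative[OF Ib w _ _ r(2)] Ib by auto
  then have eq: "AE x in lborel. x \<in> B x0 c \<longrightarrow> w x = wb x"
    using cr by (auto elim!: eventually_mono)
  let ?v = "\<lambda>t. wb (x0 + s * t)"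
  have v: "?v \<in> borel_measurable borel" using wb(1) by measurable
  have "w \<in> borel_measurable (lebesgue_on I)" using w by (auto simp: weight_def)
  then have "critical_at_0 p k ?v"
    by (rule critical_at_0_transport[OF c cI _ Ib wb(1) eq crit])
  from cheap_of_critical[OF v _ _ p this, of M k] wb have cheap: "cheap p ?v k 0" by auto
  have "\<exists>\<phi>. \<phi> \<in> test_functions (B x0 (1 / real h)) \<and> (\<forall>x. 0 \<le> \<phi> x) \<and>
           (LINT x|lebesgue_on I. \<phi> x) = 1 \<and>
           weighted_Lp_norm p I w ((deriv ^^ k) \<phi>) \<le> ennreal ((1 / real h) powr (1 / p))" if h: "h \<ge> 1" for h :: nat
  proof -
    have "0 < min c (1 / real h)" "0 < 1 / real h" using c h by auto
    then obtain u where u: "bump_in (min c (1 / real h)) u" "1 \<le> moment 0 u"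
      and cost: "cost p ?v ((deriv ^^ k) u) < ennreal (1 / real h)"
      using cheap unfolding cheap_def by blast
    obtain \<phi> where \<phi>: "\<phi> \<in> test_functions (B x0 (1 / real h))" "\<And>x. 0 \<le> \<phi> x" "(LINT x|lebesgue_on I. \<phi> x) = 1"
      "weighted_Lp_norm p I w ((deriv ^^ k) \<phi>) \<le> epowr (cost p ?v ((deriv ^^ k) u)) (1 / p)"
      using normalised_bump_transport[OF cI Ib wb(1,2) eq p u] by blast
    have "epowr (cost p ?v ((deriv ^^ k) u)) (1 / p) \<le> ennreal ((1 / real h) powr (1 / p))"
      using cost p by (intro epowr_le) auto
    with \<phi> show ?thesis by (meson order_trans)
  qed
  then obtain \<phi> where \<phi>: "\<And>h. h \<ge> 1 \<Longrightarrow> \<phi> h \<in> test_functions (B x0 (1 / real h)) \<and> (\<forall>x. 0 \<le> \<phi> h x) \<and>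
           (LINT x|lebesgue_on I. \<phi> h x) = 1 \<and>
           weighted_Lp_norm p I w ((deriv ^^ k) (\<phi> h)) \<le> ennreal ((1 / real h) powr (1 / p))"
    by metis
  have "(\<lambda>h. (1 / real h) powr (1 / p)) \<longlonglongrightarrow> 0 powr (1 / p)"
    using p by (intro tendsto_powr' lim_1_over_n tendsto_const) auto
  then have lim: "(\<lambda>h. ennreal ((1 / real h) powr (1 / p))) \<longlonglongrightarrow> ennreal 0"
    by (intro tendsto_ennrealI) simp
  have "(\<lambda>h. weighted_Lp_norm p I w ((deriv ^^ k) (\<phi> h))) \<longlonglongrightarrow> 0"
  proof (rule tendsto_sandwich[OF _ _ tendsto_const])
    show "\<forall>\<^sub>F h in sequentially. weighted_Lp_norm p I w ((deriv ^^ k) (\<phi> h)) \<le> ennreal ((1 / real h) powr (1 / p))"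
      using eventually_ge_at_top[of 1] by eventually_elim (use \<phi> in blast)
    show "(\<lambda>h. ennreal ((1 / real h) powr (1 / p))) \<longlonglongrightarrow> 0" using lim by simp
  qed simp
  with \<phi> show ?thesis by blast
qed

end

theorem theorem4p5:
  fixes a b p x0 :: real and w :: "real \<Rightarrow> real" and k :: nat and I :: "real set"
  assumes "a < b" and "I = {a<..<b}" and "1 \<le> p" and "weight I w" and "x0 \<in> closure I"
  shows "((\<exists>r>0. w \<in> L_infinity (half_ball_right x0 r \<inter> I)) \<and>
          x0 \<in> critical_set_right (real k) p I w \<longrightarrow>
          (\<exists>\<phi> :: nat \<Rightarrow> real \<Rightarrow> real.
             (\<forall>h\<ge>1. \<phi> h \<in> test_functions (half_ball_right x0 (1 / real h)) \<and>
                    (\<forall>x. 0 \<le> \<phi> h x) \<and>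
                    (LINT x|lebesgue_on I. \<phi> h x) = 1) \<and>
             (\<lambda>h. weighted_Lp_norm p I w ((deriv ^^ k) (\<phi> h))) \<longlonglongrightarrow> 0))
       \<and> ((\<exists>r>0. w \<in> L_infinity (half_ball_left x0 r \<inter> I)) \<and>
          x0 \<in> critical_set_left (real k) p I w \<longrightarrow>
          (\<exists>\<phi> :: nat \<Rightarrow> real \<Rightarrow> real.
             (\<forall>h\<ge>1. \<phi> h \<in> test_functions (half_ball_left x0 (1 / real h)) \<and>
                    (\<forall>x. 0 \<le> \<phi> h x) \<and>
                    (LINT x|lebesgue_on I. \<phi> h x) = 1) \<and>
             (\<lambda>h. weighted_Lp_norm p I w ((deriv ^^ k) (\<phi> h))) \<longlonglongrightarrow> 0))"
proof -
  interpret right: half_ball_side 1 half_ball_right x0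
    by unfold_locales (auto simp: half_ball_right_def)
  interpret left: half_ball_side "- 1" half_ball_left x0
    by unfold_locales (auto simp: half_ball_left_def)
  show ?thesis
    using right.vanishing_test_functions[OF assms(2,1,3-5)]
          left.vanishing_test_functions[OF assms(2,1,3-5)]
    by blast
qed

end
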